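(* Let $\mathcal{H}$ be an infinite-dimensional real separable Hilbert space and let $S$ be a Gaussian covariance operator on $\mathcal{H}\oplus\mathcal{H}$. Then the symplectic spectrum of $S$ lies to the right of $1$ (i.e. is contained in $[1,\infty)$), and $${d_j^R}^\downarrow(S)\le{\lambda_j^R}^\downarrow(S),\qquad j=1,2,\dots,s_R,$$ where $s_R\in\{0,1,2,\dots\}\cup\{\infty\}$ is the number of symplectic eigenvalues of $S$ lying strictly to the right of $1$, ${d_1^R}^\downarrow(S)\ge{d_2^R}^\downarrow(S)\ge\cdots$ are these symplectic eigenvalues arranged in decreasing order, and ${\lambda_1^R}^\downarrow(S)\ge{\lambda_2^R}^\downarrow(S)\ge\cdots$ are the eigenvalues of $S$ lying strictly to the right of $1$ arranged in decreasing order (all counted with multiplicity; if $s_R=\infty$ the inequality holds for all $j\ge1$).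
   Context: All operators are bounded. For a real Hilbert space, $A^T$ denotes the transpose (real adjoint) of $A$, and $\hat A(x+iy)=Ax+iAy$ denotes its complexification on the complexified Hilbert space; the spectrum and eigenvalues of $A$ are those of $\hat A$. On $\mathcal{H}\oplus\mathcal{H}$ let $J=\begin{bmatrix}0&I\\-I&0\end{bmatrix}$. A real linear, bounded, symmetric and invertible operator $S$ on $\mathcal{H}\oplus\mathcal{H}$ is a Gaussian covariance operator (GCO) if: (1) $\hat S-i\hat J\ge0$; (2) $S-I$ is Hilbert–Schmidt; (3) $(\sqrt SJ\sqrt S)^T(\sqrt SJ\sqrt S)-I$ is of trace class. (Condition (1) makes $S$ positive.) A bounded invertible operator $M$ on $\mathcal{H}\oplus\mathcal{H}$ is a symplectic transformation if $M^TJM=J$. By Williamson's normal form (known), for every positive invertible $T$ on $\mathcal{H}\oplus\mathcal{H}$ there are a positive invertible operator $D$ on $\mathcal{H}$ and a symplectic transformation $M$ with $T=M^T\begin{bmatrix}D&0\\0&D\end{bmatrix}M$, and $D$ is unique up to conjugation by an orthogonal transformation. The symplectic spectrum of $T$ is the spectrum of $D$, and the symplectic eigenvalues of $T$ are the eigenvalues of $D$ (with their multiplicities as eigenvalues of $D$). For a GCO $S$, the eigenvalues and symplectic eigenvalues of $S$ different from $1$ have finite multiplicity and are at most countably many, with $1$ as their only possible accumulation point, so the arrangements are possible; and the number of eigenvalues of $S$ strictly to the right of $1$ is at least $s_R$. *)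

theory Defs
  imports "HOL-Analysis.Analysis" "HOL-Library.Extended_Nat"
begin

section \<open>Operators on real Hilbert spaces\<close>

text \<open>
  Operators are plain functions and bounded linearity is always stated explicitly.  A real
  separable Hilbert space is a type of sort
  \<open>{real_inner, complete_space, second_countable_topology}\<close>; the product type \<open>'h \<times> 'h\<close> is the
  Hilbert space direct sum.
\<close>

definition symmetric_op :: "('a::real_inner \<Rightarrow> 'a) \<Rightarrow> bool" where
  "symmetric_op A \<longleftrightarrow> bounded_linear A \<and> (\<forall>x y. A x \<bullet> y = x \<bullet> A y)"

definition positive_op :: "('a::real_inner \<Rightarrow> 'a) \<Rightarrow> bool" where
  "positive_op A \<longleftrightarrow> symmetric_op A \<and> (\<forall>x. 0 \<le> A x \<bullet> x)"

definition invertible_op :: "('a::real_normed_vector \<Rightarrow> 'a) \<Rightarrow> bool" where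
  "invertible_op A \<longleftrightarrow> (\<exists>R. bounded_linear R \<and> R \<circ> A = id \<and> A \<circ> R = id)"

definition sqrt_op :: "('a::real_inner \<Rightarrow> 'a) \<Rightarrow> 'a \<Rightarrow> 'a" where
  "sqrt_op A = (THE R. positive_op R \<and> R \<circ> R = A)"

definition orthonormal_basis :: "('a::real_inner) set \<Rightarrow> bool" where
  "orthonormal_basis B \<longleftrightarrow>
     pairwise orthogonal B \<and> (\<forall>e\<in>B. norm e = 1) \<and> closure (span B) = UNIV"

text \<open>
  The next two conditions do not depend on the choice of the orthonormal basis.
\<close>

definition hilbert_schmidt :: "('a::real_inner \<Rightarrow> 'a) \<Rightarrow> bool" where
  "hilbert_schmidt A \<longleftrightarrow> bounded_linear A \<and>
     (\<exists>B. orthonormal_basis B \<and> (\<lambda>e. (norm (A e))\<^sup>2) summable_on B)"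

definition trace_class :: "('a::real_inner \<Rightarrow> 'a) \<Rightarrow> bool" where
  "trace_class A \<longleftrightarrow> bounded_linear A \<and>
     (\<exists>B. orthonormal_basis B \<and> (\<lambda>e. sqrt_op (adjoint A \<circ> A) e \<bullet> e) summable_on B)"

section \<open>Complexification\<close>

text \<open>
  The pair \<open>(x, y)\<close> stands for \<open>x + i y\<close>.  The norm of the product type is the Hilbert space
  norm of the complexification.
\<close>

definition cscale :: "complex \<Rightarrow> ('a::real_vector) \<times> 'a \<Rightarrow> 'a \<times> 'a" where
  "cscale c w = (Re c *\<^sub>R fst w - Im c *\<^sub>R snd w, Im c *\<^sub>R fst w + Re c *\<^sub>R snd w)"

definition cinner :: "('a::real_inner) \<times> 'a \<Rightarrow> 'a \<times> 'a \<Rightarrow> complex" where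
  "cinner v w =
     Complex (fst v \<bullet> fst w + snd v \<bullet> snd w) (snd v \<bullet> fst w - fst v \<bullet> snd w)"

definition complexify :: "('a \<Rightarrow> 'a) \<Rightarrow> 'a \<times> 'a \<Rightarrow> 'a \<times> 'a" where
  "complexify A w = (A (fst w), A (snd w))"

interpretation cplx: vector_space cscale
  by unfold_locales (auto simp: cscale_def prod_eq_iff algebra_simps)

definition cpositive :: "(('a::real_inner) \<times> 'a \<Rightarrow> 'a \<times> 'a) \<Rightarrow> bool" where
  "cpositive T \<longleftrightarrow> (\<forall>w. cinner (T w) w \<in> \<real> \<and> 0 \<le> Re (cinner (T w) w))"

text \<open>
  A real linear inverse of a complex linear map is automatically complex linear, so
  \<^const>\<open>invertible_op\<close> expresses invertibility in the complexified space.
\<close>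

definition spectrum :: "('a::real_inner \<Rightarrow> 'a) \<Rightarrow> complex set" where
  "spectrum A = {z. \<not> invertible_op (\<lambda>w. complexify A w - cscale z w)}"

definition eigenspace :: "('a::real_inner \<Rightarrow> 'a) \<Rightarrow> complex \<Rightarrow> ('a \<times> 'a) set" where
  "eigenspace A z = {w. complexify A w = cscale z w}"

text \<open>
  Complex dimension of the eigenspace; it is \<open>0\<close> iff \<open>z\<close> is not an eigenvalue.  The guard is
  needed because \<open>cplx.dim\<close> is \<open>0\<close> on infinite-dimensional spaces.
\<close>

definition multiplicity_eig :: "('a::real_inner \<Rightarrow> 'a) \<Rightarrow> complex \<Rightarrow> enat" where
  "multiplicity_eig A z =
     (if \<exists>B. finite B \<and> eigenspace A z \<subseteq> cplx.span B
      then enat (cplx.dim (eigenspace A z)) else \<infinity>)"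

section \<open>Eigenvalues to the right of one, in decreasing order\<close>

definition ecard :: "'b set \<Rightarrow> enat" where
  "ecard X = (if finite X then enat (card X) else \<infinity>)"

definition num_right_eigs :: "('a::real_inner \<Rightarrow> 'a) \<Rightarrow> enat" where
  "num_right_eigs A =
     ecard {(t::real, k::nat). 1 < t \<and> enat k < multiplicity_eig A (of_real t)}"

text \<open>
  The sequence is indexed by \<open>j = 1, 2, \<dots>\<close> with \<open>j \<le> num_right_eigs A\<close>; its values at
  other indices are irrelevant.
\<close>

definition decreasing_right_eigs :: "('a::real_inner \<Rightarrow> 'a) \<Rightarrow> (nat \<Rightarrow> real) \<Rightarrow> bool" where
  "decreasing_right_eigs A f \<longleftrightarrow>
     (let I = {j. 1 \<le> j \<and> enat j \<le> num_right_eigs A} in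
      (\<forall>j\<in>I. 1 < f j) \<and>
      (\<forall>i\<in>I. \<forall>j\<in>I. i \<le> j \<longrightarrow> f j \<le> f i) \<and>
      (\<forall>t>1. ecard {j \<in> I. f j = t} = multiplicity_eig A (of_real t)))"

definition right_eig :: "('a::real_inner \<Rightarrow> 'a) \<Rightarrow> nat \<Rightarrow> real" where
  "right_eig A = (SOME f. decreasing_right_eigs A f)"

section \<open>Gaussian covariance operators and Williamson's normal form\<close>

definition J_op :: "('h::real_vector) \<times> 'h \<Rightarrow> 'h \<times> 'h" where
  "J_op w = (snd w, - fst w)"

definition gaussian_covariance_operator ::
    "(('h::{real_inner, complete_space, second_countable_topology}) \<times> 'h \<Rightarrow> 'h \<times> 'h) \<Rightarrow> bool" where
  "gaussian_covariance_operator S \<longleftrightarrow>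
     symmetric_op S \<and> invertible_op S \<and>
     cpositive (\<lambda>w. complexify S w - cscale \<i> (complexify J_op w)) \<and>
     hilbert_schmidt (\<lambda>w. S w - w) \<and>
     (let K = sqrt_op S \<circ> J_op \<circ> sqrt_op S in trace_class (\<lambda>w. adjoint K (K w) - w))"

definition symplectic_transformation ::
    "(('h::real_inner) \<times> 'h \<Rightarrow> 'h \<times> 'h) \<Rightarrow> bool" where
  "symplectic_transformation M \<longleftrightarrow>
     bounded_linear M \<and> invertible_op M \<and> adjoint M \<circ> J_op \<circ> M = J_op"

text \<open>
  \<open>D\<close> and \<open>M\<close> form a Williamson normal form of \<open>T\<close>.  Since \<open>D\<close> is unique up to
  orthogonal conjugation, the symplectic spectrum of \<open>T\<close> is \<open>spectrum D\<close>, and the symplectic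
  eigenvalues of \<open>T\<close>, with their multiplicities, are the eigenvalues of \<open>D\<close>, for any such \<open>D\<close>.
\<close>

definition williamson_form ::
    "(('h::real_inner) \<times> 'h \<Rightarrow> 'h \<times> 'h) \<Rightarrow> ('h \<Rightarrow> 'h) \<Rightarrow> ('h \<times> 'h \<Rightarrow> 'h \<times> 'h) \<Rightarrow> bool" where
  "williamson_form T D M \<longleftrightarrow>
     positive_op D \<and> invertible_op D \<and> symplectic_transformation M \<and>
     T = adjoint M \<circ> map_prod D D \<circ> M"

end

theory Submission
  imports Defs
begin

text \<open>
  Conjugating \<open>S \<ge> i J\<close> by the symplectic \<open>M\<close> gives \<open>D \<oplus> D \<ge> i J\<close>, that is, \<open>D \<ge> I\<close>.

  Put \<open>p = (D \<oplus> D) u\<close> with \<open>u\<close> in the complexified span of eigenvectors of \<open>D\<close> with eigenvalues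
  at least \<open>t > 1\<close>.  The vector \<open>w = M\<^sup>T (p + i J p)\<close> satisfies \<open>\<parallel>w\<parallel>\<^sup>2 \<ge> 2 \<parallel>p\<parallel>\<^sup>2\<close> because \<open>M\<^sup>T\<close> is
  symplectic, and Cauchy--Schwarz for the form of \<open>D \<oplus> D\<close> turns this into
  \<open>\<langle>S w, w\<rangle> \<ge> t \<parallel>w\<parallel>\<^sup>2\<close>.  On the other hand \<open>S - I\<close> is compact, so \<open>\<langle>S w, w\<rangle> < t \<parallel>w\<parallel>\<^sup>2\<close> for nonzero \<open>w\<close>
  orthogonal to the eigenvectors of \<open>S\<close> with eigenvalues at least \<open>t\<close>.  Comparing dimensions,
  \<open>D\<close> has at most as many eigenvalues in \<open>[t, \<infinity>)\<close> as \<open>S\<close>, for every \<open>t > 1\<close>, which is the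
  claim about the decreasing arrangements.
\<close>

section \<open>Hilbert space preliminaries\<close>

subsection \<open>Orthonormal projections\<close>

definition finite_orthonormal :: "'a::real_inner set \<Rightarrow> bool" where
  "finite_orthonormal F \<longleftrightarrow> finite F \<and> pairwise orthogonal F \<and> (\<forall>e\<in>F. norm e = 1)"

text \<open>This is the orthogonal projection onto \<open>span F\<close> once \<open>F\<close> is
  finite and orthonormal.\<close>

definition proj_on :: "'a::real_inner set \<Rightarrow> 'a \<Rightarrow> 'a" where
  "proj_on F x = (\<Sum>e\<in>F. (x \<bullet> e) *\<^sub>R e)"

lemma finite_orthonormal_inner:
  assumes "finite_orthonormal F" "a \<in> F" "b \<in> F"
  shows "a \<bullet> b = (if a = b then 1 else 0)"
  using assms unfolding finite_orthonormal_def pairwise_def orthogonal_def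
  by (auto simp: norm_eq_1)

lemma finite_orthonormal_insert:
  assumes "finite_orthonormal F" "norm v = 1" "\<And>e. e \<in> F \<Longrightarrow> v \<bullet> e = 0"
  shows "finite_orthonormal (insert v F)" "v \<notin> F"
proof -
  show "finite_orthonormal (insert v F)"
    using assms unfolding finite_orthonormal_def pairwise_insert orthogonal_def
    by (auto simp: inner_commute)
  show "v \<notin> F"
    using assms(2) assms(3)[of v] by (auto simp: norm_eq_1)
qed

lemma finite_orthonormal_independent:
  assumes "finite_orthonormal F"
  shows "independent F"
  using assms pairwise_orthogonal_independent[of F]
  unfolding finite_orthonormal_def by (metis norm_zero zero_neq_one)

lemma proj_on_inner:
  assumes "finite_orthonormal F" "e \<in> F"
  shows "proj_on F x \<bullet> e = x \<bullet> e"
proof -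
  have "proj_on F x \<bullet> e = (\<Sum>a\<in>F. (x \<bullet> a) * (a \<bullet> e))"
    by (simp add: proj_on_def inner_sum_left)
  also have "\<dots> = (\<Sum>a\<in>F. if a = e then x \<bullet> a else 0)"
    using finite_orthonormal_inner[OF assms(1) _ assms(2)] by (intro sum.cong) auto
  finally show ?thesis
    using assms by (simp add: finite_orthonormal_def)
qed

lemma proj_on_span: "proj_on F x \<in> span F"
  unfolding proj_on_def by (intro span_sum span_scale span_base)

lemma diff_proj_on_orthogonal:
  assumes "finite_orthonormal F" "v \<in> span F"
  shows "(x - proj_on F x) \<bullet> v = 0"
  using assms(2)
proof (induction rule: span_induct_alt)
  case (step c e y)
  then show ?case
    using proj_on_inner[OF assms(1) step(1)] by (simp add: inner_simps)
qed simp

lemma norm_proj_on_pythagoras: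
  assumes "finite_orthonormal F"
  shows "(norm x)\<^sup>2 = (norm (proj_on F x))\<^sup>2 + (norm (x - proj_on F x))\<^sup>2"
proof -
  have "(x - proj_on F x) \<bullet> proj_on F x = 0"
    by (rule diff_proj_on_orthogonal[OF assms proj_on_span])
  then show ?thesis
    by (simp add: power2_norm_eq_inner inner_simps inner_commute)
qed

lemma norm_proj_on:
  assumes "finite_orthonormal F"
  shows "(norm (proj_on F x))\<^sup>2 = (\<Sum>e\<in>F. (x \<bullet> e)\<^sup>2)"
proof -
  have "(norm (proj_on F x))\<^sup>2 = (\<Sum>e\<in>F. (x \<bullet> e) * (proj_on F x \<bullet> e))"
    unfolding power2_norm_eq_inner by (subst (2) proj_on_def) (simp add: inner_sum_right)
  then show ?thesis
    using proj_on_inner[OF assms] by (simp add: power2_eq_square)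
qed

lemma bessel_inequality:
  assumes "finite_orthonormal F"
  shows "(\<Sum>e\<in>F. (x \<bullet> e)\<^sup>2) \<le> (norm x)\<^sup>2"
  using norm_proj_on[OF assms, of x] norm_proj_on_pythagoras[OF assms, of x] by simp

lemma diff_proj_on_le:
  assumes "finite_orthonormal F" "v \<in> span F"
  shows "norm (x - proj_on F x) \<le> norm (x - v)"
proof -
  have "(x - proj_on F x) \<bullet> (proj_on F x - v) = 0"
    using diff_proj_on_orthogonal[OF assms(1)] proj_on_span assms(2) by (meson span_diff)
  then have "(norm (x - v))\<^sup>2 = (norm (x - proj_on F x))\<^sup>2 + (norm (proj_on F x - v))\<^sup>2"
    using norm_add_Pythagorean[of "x - proj_on F x" "proj_on F x - v"]
    by (simp add: orthogonal_def)
  then have "(norm (x - proj_on F x))\<^sup>2 \<le> (norm (x - v))\<^sup>2"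
    by simp
  then show ?thesis
    by (rule power2_le_imp_le) simp
qed

text \<open>A finite substitute for Parseval: density of \<open>span B\<close> gives a finite
  \<open>F\<close> whose span comes within \<open>sqrt \<delta>\<close> of \<open>x\<close>; the
  projection onto it is at least as close, and Pythagoras bounds the missing mass by
  \<open>\<delta>\<close>.\<close>

lemma orthonormal_basis_finite_parseval:
  assumes "orthonormal_basis B" "0 < \<delta>"
  obtains F where "finite F" "F \<subseteq> B" "(norm x)\<^sup>2 \<le> (\<Sum>e\<in>F. (x \<bullet> e)\<^sup>2) + \<delta>"
proof -
  have "x \<in> closure (span B)" "0 < sqrt \<delta>"
    using assms by (auto simp: orthonormal_basis_def)
  then obtain v where v: "v \<in> span B" "dist v x < sqrt \<delta>"
    unfolding closure_approachable by blast
  then obtain F c where F: "finite F" "F \<subseteq> B" "v = (\<Sum>a\<in>F. c a *\<^sub>R a)"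
    unfolding span_explicit by blast
  then have on: "finite_orthonormal F" and vF: "v \<in> span F"
    using assms(1) unfolding orthonormal_basis_def finite_orthonormal_def
    by (auto intro: pairwise_subset span_sum span_scale span_base)
  have "norm (x - proj_on F x) \<le> sqrt \<delta>"
    using diff_proj_on_le[OF on vF, of x] v(2) by (simp add: dist_norm norm_minus_commute)
  then have "(norm (x - proj_on F x))\<^sup>2 \<le> \<delta>"
    using assms(2) by (simp add: sqrt_ge_absD)
  then show ?thesis
    using that[OF F(1,2)] norm_proj_on_pythagoras[OF on, of x] norm_proj_on[OF on, of x] by simp
qed

subsection \<open>Riesz representation and adjoints\<close>

text \<open>Evaluation at the minimizer \<open>- b / c\<close> gives the bound. If
  \<open>c = 0\<close> the expression is affine in \<open>s\<close>, and a nonzero slope would make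
  it reach \<open>-1\<close>.\<close>

lemma quadratic_nonneg_imp_discriminant:
  fixes a b c :: real
  assumes "\<And>s. 0 \<le> a + 2 * s * b + s\<^sup>2 * c" "0 \<le> c"
  shows "b\<^sup>2 \<le> a * c"
proof (cases "c = 0")
  case True
  have "b = 0"
  proof (rule ccontr)
    assume "b \<noteq> 0"
    then show False
      using assms(1)[of "- (a + 1) / (2 * b)"] True by (simp add: field_simps)
  qed
  then show ?thesis using True by simp
next
  case False
  have "0 \<le> c * (a + 2 * (- b / c) * b + (- b / c)\<^sup>2 * c)"
    by (rule mult_nonneg_nonneg[OF assms(2,1)])
  also have "\<dots> = a * c - b\<^sup>2"
    using False by (simp add: field_simps power2_eq_square)
  finally show ?thesis by simp
qed

text \<open>The representing vector minimizes \<open>\<parallel>x\<parallel>\<^sup>2 - 2 f x\<close>; the parallelogram law makes every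
  minimizing sequence Cauchy.\<close>

theorem riesz_representation:
  fixes f :: "'a::{real_inner, complete_space} \<Rightarrow> real"
  assumes "bounded_linear f"
  shows "\<exists>x. \<forall>h. f h = x \<bullet> h"
proof -
  interpret f: bounded_linear f by fact
  define g where "g x = x \<bullet> x - 2 * f x" for x
  obtain K where K: "\<And>x. norm (f x) \<le> norm x * K"
    using f.bounded by blast
  have lower: "- K\<^sup>2 \<le> g x" for x
  proof -
    have "f x \<le> norm x * K" using K[of x] by simp
    moreover have "0 \<le> (norm x - K)\<^sup>2" by simp
    ultimately show ?thesis
      by (simp add: g_def dot_square_norm power2_diff)
  qed
  define m where "m = Inf (range g)"
  have bdd: "bdd_below (range g)"
    using lower by (meson bdd_belowI2)
  have m_le: "m \<le> g x" for x
    unfolding m_def using bdd by (simp add: cInf_lower)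
  have "\<exists>x. g x < m + 1 / Suc n" for n
    using cInf_lessD[of "range g" "m + 1 / Suc n"] by (auto simp: m_def)
  then obtain X where X: "\<And>n. g (X n) < m + 1 / Suc n"
    by metis
  have par: "(norm (x - y))\<^sup>2 = 2 * (g x + g y - 2 * g ((1/2) *\<^sub>R (x + y)))" for x y
    unfolding g_def power2_norm_eq_inner
    by (simp add: f.add f.scaleR inner_simps inner_commute field_simps)
  have "Cauchy X"
  proof (rule metric_CauchyI)
    fix e :: real assume e: "0 < e"
    then obtain N where N: "4 / e\<^sup>2 < real N"
      using reals_Archimedean2 by blast
    have "dist (X i) (X j) < e" if "i \<ge> N" "j \<ge> N" for i j
    proof -
      have pos: "0 < 4 / e\<^sup>2" using e by simp
      have small: "1 / real (Suc k) < e\<^sup>2 / 4" if "k \<ge> N" for k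
      proof -
        have "4 / e\<^sup>2 < real (Suc k)" using that N by linarith
        then have "1 / real (Suc k) < 1 / (4 / e\<^sup>2)"
          using pos by (intro divide_strict_left_mono) auto
        then show ?thesis by simp
      qed
      have "g (X i) < m + e\<^sup>2 / 4" "g (X j) < m + e\<^sup>2 / 4"
        using X[of i] X[of j] small[OF that(1)] small[OF that(2)] by linarith+
      then have "2 * (g (X i) + g (X j) - 2 * g ((1/2) *\<^sub>R (X i + X j))) < e\<^sup>2"
        using m_le[of "(1/2) *\<^sub>R (X i + X j)"] by (simp add: field_simps)
      then have "(norm (X i - X j))\<^sup>2 < e\<^sup>2"
        by (simp only: par)
      then show ?thesis
        using e by (simp add: dist_norm power2_less_imp_less)
    qed
    then show "\<exists>N. \<forall>i\<ge>N. \<forall>j\<ge>N. dist (X i) (X j) < e"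
      by blast
  qed
  then obtain x where x: "X \<longlonglongrightarrow> x"
    using Cauchy_convergent convergent_def by blast
  have "(\<lambda>n. g (X n)) \<longlonglongrightarrow> g x"
    unfolding g_def by (intro tendsto_intros x f.tendsto)
  moreover have "(\<lambda>n. m + 1 / Suc n) \<longlonglongrightarrow> m + 0"
    by (intro tendsto_intros LIMSEQ_Suc[OF lim_1_over_n])
  ultimately have gx: "g x \<le> m"
    using X by (simp add: LIMSEQ_le less_imp_le)
  have "f h = x \<bullet> h" for h
  proof -
    \<comment> \<open>This is \<open>g (x + s *\<^sub>R h) - g x\<close>. With constant term
      \<open>0\<close> the discriminant bound forces the linear coefficient
      \<open>x \<bullet> h - f h\<close> to vanish.\<close>
    have "0 \<le> 0 + 2 * s * (x \<bullet> h - f h) + s\<^sup>2 * (h \<bullet> h)" for s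
      using gx m_le[of "x + s *\<^sub>R h"] unfolding g_def
      by (simp add: f.add f.scaleR inner_simps inner_commute power2_eq_square algebra_simps)
    from quadratic_nonneg_imp_discriminant[OF this] show ?thesis by simp
  qed
  then show ?thesis by blast
qed

text \<open>\<open>adjoint\<close> is defined by choice, so its characteristic identity requires
  that some adjoint exists. Riesz supplies one pointwise in \<open>y\<close>.\<close>

lemma adjoint_inner:
  fixes A :: "'a::{real_inner, complete_space} \<Rightarrow> 'b::real_inner"
  assumes "bounded_linear A"
  shows "A x \<bullet> y = x \<bullet> adjoint A y"
proof -
  have "\<exists>z. \<forall>x. A x \<bullet> y = z \<bullet> x" for y
    by (intro riesz_representation bounded_linear_inner_left_comp assms)
  then obtain B where "\<And>x y. A x \<bullet> y = B y \<bullet> x"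
    by metis
  then have *: "\<forall>x y. A x \<bullet> y = x \<bullet> B y"
    by (simp add: inner_commute)
  then show ?thesis
    using adjoint_unique[OF *] by simp
qed

subsection \<open>Coercive operators and the spectrum\<close>

text \<open>The Lax--Milgram argument: for a small step \<open>s\<close> the map sending
  \<open>x\<close> to \<open>x - s *\<^sub>R (P x - y)\<close> is a contraction, and its fixed point
  solves the equation. The choice \<open>s = c / K\<^sup>2\<close> minimizes the bound on the
  contraction factor.\<close>

lemma coercive_surj:
  fixes P :: "'a::{real_inner, complete_space} \<Rightarrow> 'a"
  assumes "bounded_linear P" and c: "0 < c" and coer: "\<And>x. c * (norm x)\<^sup>2 \<le> P x \<bullet> x"
  shows "\<exists>x. P x = y"
proof -
  interpret P: bounded_linear P by fact
  obtain K where K: "0 < K" "\<And>x. norm (P x) \<le> norm x * K"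
    using P.pos_bounded by blast
  define s where "s = c / K\<^sup>2"
  have s: "0 < s" using c K(1) by (simp add: s_def)
  \<comment> \<open>The \<open>max\<close> spares a proof of \<open>c \<le> K\<close>, which may
    fail on the zero space.\<close>
  define q where "q = sqrt (max 0 (1 - c\<^sup>2 / K\<^sup>2))"
  have q: "0 \<le> q" "q < 1"
    using c K(1) by (auto simp: q_def)
  have step: "norm (x - s *\<^sub>R P x) \<le> q * norm x" for x
  proof -
    have "(norm (x - s *\<^sub>R P x))\<^sup>2 = (norm x)\<^sup>2 - 2 * s * (P x \<bullet> x) + s\<^sup>2 * (norm (P x))\<^sup>2"
      unfolding power2_norm_eq_inner
      by (simp add: inner_simps inner_commute power2_eq_square algebra_simps)
    also have "\<dots> \<le> (norm x)\<^sup>2 - 2 * s * (c * (norm x)\<^sup>2) + s\<^sup>2 * (norm x * K)\<^sup>2"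
    proof -
      have "s * (c * (norm x)\<^sup>2) \<le> s * (P x \<bullet> x)"
        using s coer[of x] by simp
      moreover have "s\<^sup>2 * (norm (P x))\<^sup>2 \<le> s\<^sup>2 * (norm x * K)\<^sup>2"
        by (intro mult_left_mono power_mono K(2)) auto
      ultimately show ?thesis by linarith
    qed
    also have "\<dots> = (1 - c\<^sup>2 / K\<^sup>2) * (norm x)\<^sup>2"
      using K(1) by (simp add: s_def field_simps power2_eq_square)
    also have "\<dots> \<le> q\<^sup>2 * (norm x)\<^sup>2"
      by (intro mult_right_mono) (auto simp: q_def)
    finally have "(norm (x - s *\<^sub>R P x))\<^sup>2 \<le> (q * norm x)\<^sup>2"
      by (simp only: power_mult_distrib)
    then show ?thesis
      by (rule power2_le_imp_le) (simp add: q(1))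
  qed
  have "\<exists>!x. x - s *\<^sub>R (P x - y) = x"
  proof (rule banach_fix_type[OF q], intro allI)
    fix x x'
    have "x - s *\<^sub>R (P x - y) - (x' - s *\<^sub>R (P x' - y)) = (x - x') - s *\<^sub>R P (x - x')"
      by (simp add: P.diff algebra_simps)
    then show "dist (x - s *\<^sub>R (P x - y)) (x' - s *\<^sub>R (P x' - y)) \<le> q * dist x x'"
      using step[of "x - x'"] by (simp only: dist_norm)
  qed
  then show ?thesis
    using s by auto
qed

lemma invertible_op_of_bounded_below:
  fixes T :: "'a::real_normed_vector \<Rightarrow> 'a"
  assumes "bounded_linear T" and surj: "\<And>y. \<exists>x. T x = y"
    and c: "0 < c" and below: "\<And>x. c * norm x \<le> norm (T x)"
  shows "invertible_op T"
proof -
  interpret T: bounded_linear T by fact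
  have inj: "x = y" if "T x = T y" for x y
    using below[of "x - y"] that c by (simp add: T.diff mult_le_0_iff)
  define R where "R y = (SOME x. T x = y)" for y
  have TR: "T (R y) = y" for y
    unfolding R_def using someI_ex[OF surj] .
  have "bounded_linear R"
  proof (rule bounded_linear_intro[where K = "1 / c"])
    show "R (x + y) = R x + R y" for x y
      by (rule inj) (simp add: TR T.add)
    show "R (r *\<^sub>R x) = r *\<^sub>R R x" for r x
      by (rule inj) (simp add: TR T.scaleR)
    show "norm (R x) \<le> norm x * (1 / c)" for x
      using below[of "R x"] c by (simp add: TR field_simps)
  qed
  then show ?thesis
    unfolding invertible_op_def using TR inj by (intro exI[of _ R]) (auto simp: fun_eq_iff)
qed

lemma bounded_linear_complexify_diff_cscale:
  assumes "bounded_linear A"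
  shows "bounded_linear (\<lambda>w. complexify A w - cscale z w)"
  unfolding complexify_def cscale_def
  by (intro bounded_linear_sub bounded_linear_Pair bounded_linear_add
      bounded_linear_compose[OF assms] bounded_linear_const_scaleR
      bounded_linear_fst bounded_linear_snd)

text \<open>Symmetry cancels the cross terms between the real and the imaginary part of the shift.
  The last summand alone bounds the operator below when \<open>z\<close> is not real.\<close>

lemma norm_complexify_diff_cscale:
  assumes "symmetric_op A"
  shows "(norm (complexify A w - cscale z w))\<^sup>2 =
    (norm (A (fst w) - Re z *\<^sub>R fst w))\<^sup>2 + (norm (A (snd w) - Re z *\<^sub>R snd w))\<^sup>2
      + (Im z)\<^sup>2 * (norm w)\<^sup>2"
proof -
  have "A (fst w) \<bullet> snd w = A (snd w) \<bullet> fst w"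
    using assms unfolding symmetric_op_def by (metis inner_commute)
  then show ?thesis
    unfolding power2_norm_eq_inner complexify_def cscale_def
    by (simp add: inner_prod_def inner_simps inner_commute power2_eq_square algebra_simps)
qed

text \<open>For \<open>z\<close> outside the half-line, \<open>T z\<close> and its adjoint
  \<open>T (cnj z)\<close> share a lower bound \<open>c\<close>, which is the absolute value of
  \<open>Im z\<close> if that is nonzero and \<open>1 - Re z\<close> otherwise. Then
  \<open>T z \<circ> T (cnj z)\<close> is coercive, so \<open>T z\<close> is onto, and being bounded
  below it is invertible.\<close>

lemma spectrum_ge_one:
  fixes A :: "'a::{real_inner, complete_space} \<Rightarrow> 'a"
  assumes sym: "symmetric_op A" and ge: "\<And>x. (norm x)\<^sup>2 \<le> A x \<bullet> x"
  shows "spectrum A \<subseteq> complex_of_real ` {1..}"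
proof
  fix z assume z: "z \<in> spectrum A"
  have bl: "bounded_linear A" and inn: "\<And>x y. A x \<bullet> y = x \<bullet> A y"
    using sym by (auto simp: symmetric_op_def)
  define T where "T = (\<lambda>z w. complexify A w - cscale z w)"
  have blT: "bounded_linear (T z)" for z
    unfolding T_def by (rule bounded_linear_complexify_diff_cscale[OF bl])
  have adj: "T z v \<bullet> w = v \<bullet> T (cnj z) w" for v w z
    by (simp add: T_def complexify_def cscale_def inner_prod_def inner_simps inn algebra_simps)
  show "z \<in> complex_of_real ` {1..}"
  proof (rule ccontr)
    assume nz: "z \<notin> complex_of_real ` {1..}"
    have "\<exists>c>0. \<forall>w. c\<^sup>2 * (norm w)\<^sup>2 \<le> (norm (T z w))\<^sup>2 \<and> c\<^sup>2 * (norm w)\<^sup>2 \<le> (norm (T (cnj z) w))\<^sup>2"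
    proof (cases "Im z = 0")
      case False
      then show ?thesis
        by (intro exI[of _ "\<bar>Im z\<bar>"])
          (auto simp: T_def norm_complexify_diff_cscale[OF sym])
    next
      case True
      then have lt: "Re z < 1"
        using nz by (auto simp: image_iff complex_eq_iff not_le)
      have *: "(1 - Re z)\<^sup>2 * (norm x)\<^sup>2 \<le> (norm (A x - Re z *\<^sub>R x))\<^sup>2" for x
      proof -
        have "(1 - Re z) * (norm x)\<^sup>2 \<le> (A x - Re z *\<^sub>R x) \<bullet> x"
          using ge[of x] by (simp add: inner_simps dot_square_norm algebra_simps)
        also have "\<dots> \<le> norm (A x - Re z *\<^sub>R x) * norm x"
          by (rule norm_cauchy_schwarz)
        finally have "((1 - Re z) * norm x) * norm x \<le> norm (A x - Re z *\<^sub>R x) * norm x"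
          by (simp add: power2_eq_square)
        then have "(1 - Re z) * norm x \<le> norm (A x - Re z *\<^sub>R x)"
          by (cases "x = 0") auto
        then have "((1 - Re z) * norm x)\<^sup>2 \<le> (norm (A x - Re z *\<^sub>R x))\<^sup>2"
          using lt by (intro power_mono) auto
        then show ?thesis by (simp add: power_mult_distrib)
      qed
      have "(norm w)\<^sup>2 = (norm (fst w))\<^sup>2 + (norm (snd w))\<^sup>2" for w :: "'a \<times> 'a"
        by (simp add: norm_prod_def)
      then have "(1 - Re z)\<^sup>2 * (norm w)\<^sup>2 \<le> (norm (T z' w))\<^sup>2" if "Re z' = Re z" for w z'
        unfolding T_def norm_complexify_diff_cscale[OF sym] that
        using add_mono[OF *[of "fst w"] *[of "snd w"]]
        by (simp only: distrib_left) (simp add: add_increasing2)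
      then show ?thesis
        using lt by (intro exI[of _ "1 - Re z"]) auto
    qed
    then obtain c where c: "0 < c" "\<And>w. c\<^sup>2 * (norm w)\<^sup>2 \<le> (norm (T z w))\<^sup>2"
      "\<And>w. c\<^sup>2 * (norm w)\<^sup>2 \<le> (norm (T (cnj z) w))\<^sup>2"
      by blast
    have "\<exists>x. T z x = y" for y
    proof -
      have "\<exists>x. (\<lambda>w. T z (T (cnj z) w)) x = y"
      proof (rule coercive_surj)
        show "bounded_linear (\<lambda>w. T z (T (cnj z) w))"
          by (rule bounded_linear_compose[OF blT blT])
        show "c\<^sup>2 * (norm x)\<^sup>2 \<le> T z (T (cnj z) x) \<bullet> x" for x
          using c(3)[of x] by (simp add: adj power2_norm_eq_inner)
      qed (use c in simp)
      then show ?thesis by blast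
    qed
    moreover have "c * norm w \<le> norm (T z w)" for w
      using c(2)[of w] by (metis norm_ge_zero power2_le_imp_le power_mult_distrib)
    ultimately have "invertible_op (T z)"
      using invertible_op_of_bounded_below[OF blT _ c(1)] by blast
    then show False
      using z by (simp add: spectrum_def T_def)
  qed
qed

section \<open>Hilbert--Schmidt operators\<close>

text \<open>Frees the Hilbert--Schmidt condition from its unspecified basis. By symmetry the double
  sum of \<open>(A f \<bullet> b)\<^sup>2\<close> can be read from either side: approximate Parseval
  in \<open>B\<close> bounds it from below, Bessel for \<open>F\<close> from above.\<close>

lemma hilbert_schmidt_orthonormal_bound:
  fixes A :: "'a::real_inner \<Rightarrow> 'a"
  assumes "hilbert_schmidt A" and sym: "symmetric_op A"
  shows "\<exists>C. \<forall>F. finite_orthonormal F \<longrightarrow> (\<Sum>f\<in>F. (norm (A f))\<^sup>2) \<le> C"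
proof -
  obtain B where B: "orthonormal_basis B" "(\<lambda>e. (norm (A e))\<^sup>2) summable_on B"
    using assms(1) by (auto simp: hilbert_schmidt_def)
  define C where "C = infsum (\<lambda>e. (norm (A e))\<^sup>2) B"
  have inn: "A x \<bullet> y = A y \<bullet> x" for x y
    using sym unfolding symmetric_op_def by (metis inner_commute)
  have "(\<Sum>f\<in>F. (norm (A f))\<^sup>2) \<le> C" if F: "finite_orthonormal F" for F
  proof (rule field_le_epsilon)
    fix e :: real assume e: "0 < e"
    \<comment> \<open>One error \<open>\<delta>\<close> is made for each element of
      \<open>F\<close>, and they must total at most \<open>e\<close>. The added \<open>1\<close>
      keeps the quotient meaningful for empty \<open>F\<close>.\<close>
    define \<delta> where "\<delta> = e / (1 + real (card F))"
    have \<delta>: "0 < \<delta>" using e by (simp add: \<delta>_def)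
    have "\<forall>f. \<exists>E. finite E \<and> E \<subseteq> B \<and> (norm (A f))\<^sup>2 \<le> (\<Sum>b\<in>E. (A f \<bullet> b)\<^sup>2) + \<delta>"
    proof
      fix f
      obtain E where "finite E" "E \<subseteq> B" "(norm (A f))\<^sup>2 \<le> (\<Sum>b\<in>E. (A f \<bullet> b)\<^sup>2) + \<delta>"
        by (rule orthonormal_basis_finite_parseval[OF B(1) \<delta>])
      then show "\<exists>E. finite E \<and> E \<subseteq> B \<and> (norm (A f))\<^sup>2 \<le> (\<Sum>b\<in>E. (A f \<bullet> b)\<^sup>2) + \<delta>"
        by (intro exI[of _ E] conjI)
    qed
    from choice[OF this] obtain E where E: "\<And>f. finite (E f)" "\<And>f. E f \<subseteq> B"
      "\<And>f. (norm (A f))\<^sup>2 \<le> (\<Sum>b\<in>E f. (A f \<bullet> b)\<^sup>2) + \<delta>"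
      by blast
    define G where "G = (\<Union>f\<in>F. E f)"
    have G: "finite G" "G \<subseteq> B"
      using F E by (auto simp: G_def finite_orthonormal_def)
    have "(\<Sum>f\<in>F. (norm (A f))\<^sup>2) \<le> (\<Sum>f\<in>F. (\<Sum>b\<in>G. (A f \<bullet> b)\<^sup>2) + \<delta>)"
    proof (rule sum_mono)
      fix f assume "f \<in> F"
      then have "(\<Sum>b\<in>E f. (A f \<bullet> b)\<^sup>2) \<le> (\<Sum>b\<in>G. (A f \<bullet> b)\<^sup>2)"
        using G by (intro sum_mono2) (auto simp: G_def)
      then show "(norm (A f))\<^sup>2 \<le> (\<Sum>b\<in>G. (A f \<bullet> b)\<^sup>2) + \<delta>"
        using E(3)[of f] by linarith
    qed
    also have "\<dots> = (\<Sum>b\<in>G. \<Sum>f\<in>F. (A f \<bullet> b)\<^sup>2) + real (card F) * \<delta>"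
      by (simp add: sum.distrib sum.swap[of _ F])
    also have "(\<Sum>b\<in>G. \<Sum>f\<in>F. (A f \<bullet> b)\<^sup>2) \<le> (\<Sum>b\<in>G. (norm (A b))\<^sup>2)"
    proof (rule sum_mono)
      show "(\<Sum>f\<in>F. (A f \<bullet> b)\<^sup>2) \<le> (norm (A b))\<^sup>2" for b
        using bessel_inequality[OF F, of "A b"] by (subst inn) simp
    qed
    also have "(\<Sum>b\<in>G. (norm (A b))\<^sup>2) \<le> C"
      unfolding C_def using G B(2) by (intro finite_sum_le_infsum) auto
    also have "real (card F) * \<delta> \<le> e"
      using e by (simp add: \<delta>_def field_simps)
    finally show "(\<Sum>f\<in>F. (norm (A f))\<^sup>2) \<le> C + e"
      by simp
  qed
  then show ?thesis by blast
qed

section \<open>Compactness of Hilbert--Schmidt operators\<close>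

text \<open>Choose \<open>F\<close> whose sum is within \<open>e\<^sup>2\<close> of the supremum
  over all finite orthonormal families. Adjoining a unit vector \<open>u\<close> orthogonal to
  \<open>F\<close> adds \<open>(norm (A u))\<^sup>2\<close> to the sum, so this can be at most
  \<open>e\<^sup>2\<close>.\<close>

lemma finite_orthonormal_tail:
  fixes A :: "'a::real_inner \<Rightarrow> 'b::real_inner"
  assumes "linear A"
    and bound: "\<And>F. finite_orthonormal F \<Longrightarrow> (\<Sum>f\<in>F. (norm (A f))\<^sup>2) \<le> C"
    and e: "0 < e"
  obtains F where "finite_orthonormal F"
    "\<And>x. (\<And>f. f \<in> F \<Longrightarrow> x \<bullet> f = 0) \<Longrightarrow> norm (A x) \<le> e * norm x"
proof -
  interpret A: linear A by fact
  define X where "X = (\<lambda>F. \<Sum>f\<in>F. (norm (A f))\<^sup>2) ` {F. finite_orthonormal F}"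
  have "finite_orthonormal ({} :: 'a set)"
    by (simp add: finite_orthonormal_def)
  then have ne: "X \<noteq> {}" by (auto simp: X_def)
  have bdd: "bdd_above X"
    using bound by (auto simp: X_def bdd_above_def)
  have "Sup X - e\<^sup>2 < Sup X" using e by simp
  then obtain F where F: "finite_orthonormal F" "Sup X - e\<^sup>2 < (\<Sum>f\<in>F. (norm (A f))\<^sup>2)"
    using less_cSupD[OF ne, of "Sup X - e\<^sup>2"] unfolding X_def by blast
  have "norm (A x) \<le> e * norm x" if x: "\<And>f. f \<in> F \<Longrightarrow> x \<bullet> f = 0" for x
  proof (cases "x = 0")
    case False
    define u where "u = x /\<^sub>R norm x"
    have u: "norm u = 1" "\<And>f. f \<in> F \<Longrightarrow> u \<bullet> f = 0"
      using False x by (auto simp: u_def)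
    note ins = finite_orthonormal_insert[OF F(1) u]
    have "(norm (A u))\<^sup>2 + (\<Sum>f\<in>F. (norm (A f))\<^sup>2) \<in> X"
      unfolding X_def using ins F(1)
      by (intro image_eqI[of _ _ "insert u F"]) (auto simp: finite_orthonormal_def)
    then have "(norm (A u))\<^sup>2 + (\<Sum>f\<in>F. (norm (A f))\<^sup>2) \<le> Sup X"
      by (rule cSup_upper[OF _ bdd])
    then have "(norm (A u))\<^sup>2 \<le> e\<^sup>2"
      using F(2) by linarith
    then have "norm (A u) \<le> e"
      by (rule power2_le_imp_le) (use e in simp)
    then have "norm x * norm (A u) \<le> norm x * e"
      by (rule mult_left_mono) simp
    moreover have "x = norm x *\<^sub>R u"
      using False by (simp add: u_def)
    then have "norm (A x) = norm x * norm (A u)"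
      by (metis A.scaleR norm_scaleR abs_norm_cancel)
    ultimately show ?thesis
      by (simp only: mult.commute)
  qed simp
  with F(1) show thesis by (rule that)
qed

text \<open>The set is a Minkowski sum of finitely many compact segments. It will contain the images
  of the projections of a bounded sequence.\<close>

lemma compact_coefficient_sums:
  fixes v :: "'i \<Rightarrow> 'b::real_normed_vector"
  assumes "finite F"
  shows "compact {\<Sum>f\<in>F. c f *\<^sub>R v f | c. \<forall>f\<in>F. \<bar>c f\<bar> \<le> (R::real)}"
  using assms
proof induction
  case empty
  then show ?case by simp
next
  case (insert g F)
  let ?S = "\<lambda>F. {\<Sum>f\<in>F. c f *\<^sub>R v f | c. \<forall>f\<in>F. \<bar>c f\<bar> \<le> R}"
  have "compact ((\<lambda>s. s *\<^sub>R v g) ` {-R..R})"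
    by (intro compact_continuous_image continuous_intros) auto
  then have "compact {x + y | x y. x \<in> (\<lambda>s. s *\<^sub>R v g) ` {-R..R} \<and> y \<in> ?S F}"
    by (rule compact_sums[OF _ insert.IH])
  also have "{x + y | x y. x \<in> (\<lambda>s. s *\<^sub>R v g) ` {-R..R} \<and> y \<in> ?S F} = ?S (insert g F)"
  proof (intro equalityI subsetI)
    fix z assume "z \<in> {x + y | x y. x \<in> (\<lambda>s. s *\<^sub>R v g) ` {-R..R} \<and> y \<in> ?S F}"
    then obtain s c where sc: "z = s *\<^sub>R v g + (\<Sum>f\<in>F. c f *\<^sub>R v f)" "\<bar>s\<bar> \<le> R" "\<forall>f\<in>F. \<bar>c f\<bar> \<le> R"
      by (auto simp: abs_le_iff)
    have "(\<Sum>f\<in>F. (c(g := s)) f *\<^sub>R v f) = (\<Sum>f\<in>F. c f *\<^sub>R v f)"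
      using insert.hyps by (intro sum.cong) auto
    then have "z = (\<Sum>f\<in>insert g F. (c(g := s)) f *\<^sub>R v f)"
      using sc insert.hyps by simp
    then show "z \<in> ?S (insert g F)"
      using sc by (auto intro!: exI[of _ "c(g := s)"])
  next
    fix z assume "z \<in> ?S (insert g F)"
    then obtain c where "z = c g *\<^sub>R v g + (\<Sum>f\<in>F. c f *\<^sub>R v f)" "\<forall>f\<in>insert g F. \<bar>c f\<bar> \<le> R"
      using insert.hyps by auto
    then show "z \<in> {x + y | x y. x \<in> (\<lambda>s. s *\<^sub>R v g) ` {-R..R} \<and> y \<in> ?S F}"
      by (fastforce simp: abs_le_iff)
  qed
  finally show ?case .
qed

text \<open>The range of the image sequence is totally bounded: the projection of \<open>X n\<close>
  onto a suitable finite \<open>F\<close> is sent into a compact set of coefficient sums, and the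
  remainder is sent to a vector of norm at most \<open>e / 2\<close>.\<close>

lemma hilbert_schmidt_convergent_subsequence:
  fixes A :: "'a::{real_inner, complete_space} \<Rightarrow> 'a"
  assumes "linear A"
    and bound: "\<And>F. finite_orthonormal F \<Longrightarrow> (\<Sum>f\<in>F. (norm (A f))\<^sup>2) \<le> C"
    and X: "\<And>n::nat. norm (X n) \<le> 1"
  obtains y r where "strict_mono r" "(\<lambda>n. A (X (r n))) \<longlonglongrightarrow> y"
proof -
  interpret A: linear A by fact
  have tb: "\<exists>k. finite k \<and> range (\<lambda>n. A (X n)) \<subseteq> (\<Union>x\<in>k. ball x e)" if e: "0 < e" for e
  proof -
    obtain F where F: "finite_orthonormal F"
      "\<And>x. (\<And>f. f \<in> F \<Longrightarrow> x \<bullet> f = 0) \<Longrightarrow> norm (A x) \<le> e / 2 * norm x"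
      using finite_orthonormal_tail[OF assms(1) bound, of "e / 2"] e by auto
    let ?K = "{\<Sum>f\<in>F. c f *\<^sub>R A f | c. \<forall>f\<in>F. \<bar>c f\<bar> \<le> (1::real)}"
    have "compact ?K"
      using F(1) by (intro compact_coefficient_sums) (simp add: finite_orthonormal_def)
    then obtain k where k: "finite k" "?K \<subseteq> (\<Union>x\<in>k. ball x (e / 2))"
      using e unfolding compact_eq_totally_bounded by (meson half_gt_zero)
    have "\<exists>x\<in>k. A (X n) \<in> ball x e" for n
    proof -
      have "A (proj_on F (X n)) = (\<Sum>f\<in>F. (X n \<bullet> f) *\<^sub>R A f)"
        by (simp add: proj_on_def A.sum A.scaleR)
      moreover have "\<bar>X n \<bullet> f\<bar> \<le> 1" if "f \<in> F" for f
        using Cauchy_Schwarz_ineq2[of "X n" f] X[of n] F(1) that by (simp add: finite_orthonormal_def)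
      ultimately have "A (proj_on F (X n)) \<in> ?K"
        by blast
      then obtain x where x: "x \<in> k" "dist x (A (proj_on F (X n))) < e / 2"
        using k(2) by (auto simp: subset_iff)
      have "norm (A (X n - proj_on F (X n))) \<le> e / 2 * norm (X n - proj_on F (X n))"
        by (rule F(2)) (simp add: inner_diff_left proj_on_inner[OF F(1)])
      also have "\<dots> \<le> e / 2 * 1"
      proof -
        have "norm (X n - proj_on F (X n)) \<le> 1"
          using diff_proj_on_le[OF F(1) span_zero, of "X n"] X[of n] by simp
        then show ?thesis using e by (intro mult_left_mono) auto
      qed
      finally have "dist (A (proj_on F (X n))) (A (X n)) \<le> e / 2"
        by (simp add: dist_norm A.diff norm_minus_commute)
      then have "dist x (A (X n)) < e"
        using x(2) dist_triangle[of x "A (X n)" "A (proj_on F (X n))"] by linarith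
      then show ?thesis using x(1) by auto
    qed
    then show ?thesis using k(1) by blast
  qed
  \<comment> \<open>Total boundedness passes to the closure by covering with closed balls of half
    the radius. Completeness of the space then makes the closure compact.\<close>
  have "\<exists>k. finite k \<and> closure (range (\<lambda>n. A (X n))) \<subseteq> (\<Union>x\<in>k. ball x e)" if e: "0 < e" for e
  proof -
    obtain k where k: "finite k" "range (\<lambda>n. A (X n)) \<subseteq> (\<Union>x\<in>k. ball x (e / 2))"
      using tb[of "e / 2"] e by auto
    have "range (\<lambda>n. A (X n)) \<subseteq> (\<Union>x\<in>k. cball x (e / 2))"
      by (rule order_trans[OF k(2)]) (intro UN_mono order_refl ball_subset_cball)
    then have "closure (range (\<lambda>n. A (X n))) \<subseteq> (\<Union>x\<in>k. cball x (e / 2))"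
      using k(1) by (intro closure_minimal closed_UN) auto
    also have "\<dots> \<subseteq> (\<Union>x\<in>k. ball x e)"
      using e by (intro UN_mono) auto
    finally show ?thesis using k(1) by blast
  qed
  then have "compact (closure (range (\<lambda>n. A (X n))))"
    by (simp add: compact_eq_totally_bounded complete_eq_closed)
  then have "seq_compact (closure (range (\<lambda>n. A (X n))))"
    by (simp add: compact_eq_seq_compact_metric)
  moreover have "\<forall>n. A (X n) \<in> closure (range (\<lambda>n. A (X n)))"
    by (intro allI subsetD[OF closure_subset] rangeI)
  ultimately obtain l r where "strict_mono r" "((\<lambda>n. A (X n)) \<circ> r) \<longlonglongrightarrow> l"
    by (rule seq_compactE)
  then show thesis
    by (intro that[of r l]) (auto simp: o_def)
qed

section \<open>Orthonormal systems of eigenvectors\<close>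

definition eigsystem :: "('a::real_inner \<Rightarrow> 'a) \<Rightarrow> real \<Rightarrow> 'a set \<Rightarrow> bool" where
  "eigsystem A t F \<longleftrightarrow> finite_orthonormal F \<and> (\<forall>v\<in>F. \<exists>s\<ge>t. A v = s *\<^sub>R v)"

text \<open>Such an \<open>F\<close> takes the place of a spectral projection for
  \<open>[t, \<infinity>)\<close>. Maximality refers to cardinality, so that dimensions can be
  compared through \<open>card F\<close>.\<close>

definition max_eigsystem :: "('a::real_inner \<Rightarrow> 'a) \<Rightarrow> real \<Rightarrow> 'a set \<Rightarrow> bool" where
  "max_eigsystem A t F \<longleftrightarrow> eigsystem A t F \<and> (\<forall>G. eigsystem A t G \<longrightarrow> card G \<le> card F)"

lemma max_eigsystem_exists:
  assumes "\<And>F. eigsystem A t F \<Longrightarrow> card F \<le> n"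
  obtains F where "max_eigsystem A t F"
proof -
  have "eigsystem A t {}"
    by (simp add: eigsystem_def finite_orthonormal_def)
  moreover have "\<forall>F. eigsystem A t F \<longrightarrow> card F < Suc n"
    using assms by (simp add: less_Suc_eq_le)
  ultimately have "\<exists>F. eigsystem A t F \<and> (\<forall>G. eigsystem A t G \<longrightarrow> card G \<le> card F)"
    by (rule ex_has_greatest_nat)
  then show thesis
    using that unfolding max_eigsystem_def by (elim exE)
qed

text \<open>Otherwise the normalized vector could be adjoined to \<open>F\<close>, giving a larger
  system.\<close>

lemma max_eigsystem_orthogonal_eigenvector:
  assumes F: "max_eigsystem A t F" and "linear A"
    and w: "\<And>v. v \<in> F \<Longrightarrow> w \<bullet> v = 0" "A w = s *\<^sub>R w" "t \<le> s"
  shows "w = 0"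
proof (rule ccontr)
  interpret A: linear A by fact
  assume "w \<noteq> 0"
  define u where "u = w /\<^sub>R norm w"
  have on: "finite_orthonormal F" using F by (simp add: max_eigsystem_def eigsystem_def)
  have "norm u = 1" "\<And>v. v \<in> F \<Longrightarrow> u \<bullet> v = 0"
    using \<open>w \<noteq> 0\<close> w by (auto simp: u_def)
  note ins = finite_orthonormal_insert[OF on this]
  have "A u = s *\<^sub>R u"
    by (simp add: u_def A.scaleR w(2))
  then have "eigsystem A t (insert u F)"
    using ins F w(3) by (auto simp: max_eigsystem_def eigsystem_def)
  then have "card (insert u F) \<le> card F"
    using F by (simp add: max_eigsystem_def)
  then show False
    using ins on by (simp add: finite_orthonormal_def)
qed

lemma symmetric_op_eigenvectors_orthogonal:
  assumes "symmetric_op A" "A v = s *\<^sub>R v" "A w = r *\<^sub>R w" "s \<noteq> r"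
  shows "v \<bullet> w = 0"
proof -
  have "s * (v \<bullet> w) = r * (v \<bullet> w)"
    using assms unfolding symmetric_op_def by (metis inner_scaleR_left inner_scaleR_right)
  then show ?thesis using assms(4) by simp
qed

text \<open>Subtract from an eigenvector its projection onto the members of \<open>F\<close> with
  the same eigenvalue. The remainder is an eigenvector or zero, is orthogonal to the other members
  by symmetry, and so vanishes by maximality.\<close>

lemma max_eigsystem_span:
  assumes F: "max_eigsystem A t F" and sym: "symmetric_op A" and "t \<le> s"
  shows "{w. A w = s *\<^sub>R w} = span {v \<in> F. A v = s *\<^sub>R v}" (is "?E = span ?F")
proof
  have "linear A"
    using sym by (simp add: symmetric_op_def bounded_linear.linear)
  then interpret A: linear A .
  have on: "finite_orthonormal F" using F by (simp add: max_eigsystem_def eigsystem_def)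
  then have on': "finite_orthonormal ?F"
    by (auto simp: finite_orthonormal_def intro: pairwise_subset)
  have sub: "subspace ?E"
    by (auto simp: subspace_def A.add A.scaleR scaleR_add_right)
  then show "span ?F \<subseteq> ?E"
    by (intro span_minimal) auto
  show "?E \<subseteq> span ?F"
  proof
    fix w assume w: "w \<in> ?E"
    have "proj_on ?F w \<in> ?E"
      using proj_on_span \<open>span ?F \<subseteq> ?E\<close> by blast
    then have d: "w - proj_on ?F w \<in> ?E"
      using subspace_diff[OF sub w] by blast
    have "(w - proj_on ?F w) \<bullet> v = 0" if v: "v \<in> F" for v
    proof -
      obtain r where r: "A v = r *\<^sub>R v"
        using F v by (auto simp: max_eigsystem_def eigsystem_def)
      show ?thesis
      proof (cases "r = s")
        case True
        then have "v \<in> ?F" using v r by simp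
        then show ?thesis by (intro diff_proj_on_orthogonal[OF on'] span_base)
      next
        case False
        show ?thesis
          by (rule symmetric_op_eigenvectors_orthogonal[OF sym _ r, of _ s])
            (use d \<open>r \<noteq> s\<close> in simp_all)
      qed
    qed
    then have "w - proj_on ?F w = 0"
      using max_eigsystem_orthogonal_eigenvector[OF F \<open>linear A\<close>] d \<open>t \<le> s\<close> by blast
    then show "w \<in> span ?F"
      using proj_on_span[of ?F w] by simp
  qed
qed

section \<open>Multiplicities in the complexification and counting of eigenvalues\<close>

lemma eigenspace_of_real:
  "eigenspace A (of_real s) = {w. A (fst w) = s *\<^sub>R fst w \<and> A (snd w) = s *\<^sub>R snd w}"
  by (auto simp: eigenspace_def complexify_def cscale_def prod_eq_iff)

text \<open>For real \<open>s\<close> the complex eigenspace is the complexification of the real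
  one, so a real basis \<open>G\<close>, embedded as the vectors \<open>(g, 0)\<close>, is a complex
  basis.\<close>

lemma multiplicity_eig_of_real:
  assumes E: "{w. A w = s *\<^sub>R w} = span G" and G: "finite G" "independent G"
  shows "multiplicity_eig A (of_real s) = enat (card G)"
proof -
  define H where "H = (\<lambda>g. (g, 0 :: 'a)) ` G"
  have inj: "inj_on (\<lambda>g. (g, 0 :: 'a)) G"
    by (auto simp: inj_on_def)
  have mem: "w \<in> eigenspace A (of_real s) \<longleftrightarrow> fst w \<in> span G \<and> snd w \<in> span G" for w
    unfolding eigenspace_of_real E[symmetric] by simp
  have real_in: "(a, 0) \<in> cplx.span H" if "a \<in> span G" for a
    using that
  proof (induction rule: span_induct_alt)
    case base
    then show ?case using cplx.span_zero[of H] by (simp add: zero_prod_def)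
  next
    case (step c g a)
    have "(g, 0) \<in> H" using step(1) by (simp add: H_def)
    then have "cscale (of_real c) (g, 0) + (a, 0) \<in> cplx.span H"
      by (intro cplx.span_add cplx.span_scale step(2) cplx.span_base)
    moreover have "cscale (of_real c) (g, 0) + (a, 0) = (c *\<^sub>R g + a, 0)"
      by (simp add: cscale_def)
    ultimately show ?case by (simp only:)
  qed
  have span: "eigenspace A (of_real s) = cplx.span H"
  proof
    show "eigenspace A (of_real s) \<subseteq> cplx.span H"
    proof
      fix w assume "w \<in> eigenspace A (of_real s)"
      then have "(fst w, 0) + cscale \<i> (snd w, 0) \<in> cplx.span H"
        using real_in mem by (intro cplx.span_add cplx.span_scale) auto
      then show "w \<in> cplx.span H" by (simp add: cscale_def)
    qed
    show "cplx.span H \<subseteq> eigenspace A (of_real s)"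
    proof (rule cplx.span_minimal)
      show "H \<subseteq> eigenspace A (of_real s)"
        by (auto simp: H_def mem span_base span_zero)
      show "cplx.subspace (eigenspace A (of_real s))"
        by (auto simp: cplx.subspace_def mem cscale_def span_zero
            intro!: span_add span_diff span_scale)
    qed
  qed
  have "cplx.independent H"
  proof (rule cplx.independent_if_scalars_zero)
    show "finite H" using G by (simp add: H_def)
    fix f x assume sum0: "(\<Sum>x\<in>H. cscale (f x) x) = 0" and x: "x \<in> H"
    have "(\<Sum>g\<in>G. cscale (f (g, 0)) (g, 0)) = 0"
      using sum0 inj by (simp add: H_def sum.reindex)
    then have "(\<Sum>g\<in>G. (Re (f (g, 0)) *\<^sub>R g, Im (f (g, 0)) *\<^sub>R g)) = 0"
      by (simp add: cscale_def)
    then have "(\<Sum>g\<in>G. Re (f (g, 0)) *\<^sub>R g) = 0" "(\<Sum>g\<in>G. Im (f (g, 0)) *\<^sub>R g) = 0"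
      by (auto simp: prod_eq_iff fst_sum snd_sum)
    then have "\<forall>g\<in>G. Re (f (g, 0)) = 0 \<and> Im (f (g, 0)) = 0"
      using independentD[OF G(2,1) order_refl, of "\<lambda>g. Re (f (g, 0))"]
        independentD[OF G(2,1) order_refl, of "\<lambda>g. Im (f (g, 0))"] by simp
    then show "f x = 0"
      using x by (auto simp: H_def complex_eq_iff)
  qed
  then have "cplx.dim (eigenspace A (of_real s)) = card H"
    unfolding span by (simp add: cplx.dim_eq_card_independent)
  moreover have "card H = card G"
    unfolding H_def by (rule card_image[OF inj])
  moreover have "finite H" using G by (simp add: H_def)
  ultimately show ?thesis
    unfolding multiplicity_eig_def using span by auto
qed

text \<open>The second component numbers the copies of the eigenvalue \<open>s\<close>, so that the
  cardinality counts with multiplicity.\<close>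

definition eigs_above :: "('a::real_inner \<Rightarrow> 'a) \<Rightarrow> real \<Rightarrow> (real \<times> nat) set" where
  "eigs_above A t = {(s, k). t \<le> s \<and> enat k < multiplicity_eig A (of_real s)}"

text \<open>Each \<open>v\<close> in \<open>F\<close> has its eigenvalue as Rayleigh quotient
  \<open>e v\<close>. The fibres of \<open>e\<close> partition \<open>F\<close>, and the fibre over
  \<open>s\<close> is a basis of the eigenspace, hence has as many elements as the multiplicity of
  \<open>s\<close>.\<close>

lemma card_eigs_above:
  assumes F: "max_eigsystem A t F" and sym: "symmetric_op A"
  shows "finite (eigs_above A t)" "card (eigs_above A t) = card F"
proof -
  have on: "finite_orthonormal F" and es: "\<And>v. v \<in> F \<Longrightarrow> \<exists>s\<ge>t. A v = s *\<^sub>R v"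
    using F by (auto simp: max_eigsystem_def eigsystem_def)
  then have fin: "finite F" by (simp add: finite_orthonormal_def)
  define e where "e v = A v \<bullet> v" for v
  have ev: "e v = s" if "v \<in> F" "A v = s *\<^sub>R v" for v s
    using that finite_orthonormal_inner[OF on, of v v] by (simp add: e_def)
  have lev: "{v \<in> F. A v = s *\<^sub>R v} = {v \<in> F. e v = s}" for s
    using ev es by blast
  have mult: "multiplicity_eig A (of_real s) = enat (card {v \<in> F. e v = s})" if "t \<le> s" for s
  proof (rule multiplicity_eig_of_real)
    show "{w. A w = s *\<^sub>R w} = span {v \<in> F. e v = s}"
      using max_eigsystem_span[OF F sym that] by (simp add: lev)
    show "independent {v \<in> F. e v = s}"
      by (rule independent_mono[OF finite_orthonormal_independent[OF on]]) auto
  qed (use fin in simp)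
  have ge: "t \<le> e v" if "v \<in> F" for v
    using es[OF that] ev[OF that] by auto
  have im: "s \<in> e ` F" if "k < card {v \<in> F. e v = s}" for s and k :: nat
  proof (rule ccontr)
    assume "s \<notin> e ` F"
    then have "{v \<in> F. e v = s} = {}" by blast
    with that show False by simp
  qed
  have "(s, k) \<in> eigs_above A t \<longleftrightarrow> s \<in> e ` F \<and> k < card {v \<in> F. e v = s}" for s k
  proof -
    have "(s, k) \<in> eigs_above A t \<longleftrightarrow> t \<le> s \<and> k < card {v \<in> F. e v = s}"
      by (cases "t \<le> s") (simp_all add: eigs_above_def mult)
    then show ?thesis using im ge by blast
  qed
  then have eq: "eigs_above A t = (SIGMA s:e ` F. {..<card {v \<in> F. e v = s}})"
    by (intro set_eqI) (simp only: split_paired_all mem_Sigma_iff lessThan_iff)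
  show "finite (eigs_above A t)"
    unfolding eq using fin by simp
  show "card (eigs_above A t) = card F"
    unfolding eq using fin sum.image_gen[OF fin, of "\<lambda>_. 1::nat" e] by simp
qed

section \<open>Variational characterization above one\<close>

text \<open>The form is nonnegative along the line \<open>x + s *\<^sub>R y\<close>, so its
  discriminant is controlled. The subspace \<open>N\<close> allows forms that are semidefinite only
  on an orthogonal complement.\<close>

lemma semidefinite_cauchy_schwarz:
  assumes "linear T" "subspace N" "\<And>x. x \<in> N \<Longrightarrow> 0 \<le> T x \<bullet> x"
    and sym: "\<And>x y. T x \<bullet> y = x \<bullet> T y" and "x \<in> N" "y \<in> N"
  shows "(T x \<bullet> y)\<^sup>2 \<le> (T x \<bullet> x) * (T y \<bullet> y)"
proof (rule quadratic_nonneg_imp_discriminant)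
  interpret T: linear T by fact
  fix s :: real
  have "x + s *\<^sub>R y \<in> N"
    using assms by (intro subspace_add subspace_scale)
  then have "0 \<le> T (x + s *\<^sub>R y) \<bullet> (x + s *\<^sub>R y)"
    by (rule assms(3))
  also have "T y \<bullet> x = T x \<bullet> y"
    by (metis sym inner_commute)
  then have "T (x + s *\<^sub>R y) \<bullet> (x + s *\<^sub>R y) = T x \<bullet> x + 2 * s * (T x \<bullet> y) + s\<^sup>2 * (T y \<bullet> y)"
    by (simp add: T.add T.scaleR inner_simps power2_eq_square algebra_simps)
  finally show "0 \<le> T x \<bullet> x + 2 * s * (T x \<bullet> y) + s\<^sup>2 * (T y \<bullet> y)" .
next
  show "0 \<le> T y \<bullet> y" using assms by simp
qed

text \<open>Every member of the system contributes at least \<open>(t - 1)\<^sup>2\<close> to a sum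
  that never exceeds \<open>C\<close>.\<close>

lemma eigsystem_card_bound:
  fixes S :: "'a::real_inner \<Rightarrow> 'a"
  assumes bound: "\<And>F. finite_orthonormal F \<Longrightarrow> (\<Sum>f\<in>F. (norm (S f - f))\<^sup>2) \<le> C"
    and "1 < t" "eigsystem S t F"
  shows "card F \<le> nat \<lfloor>C / (t - 1)\<^sup>2\<rfloor>"
proof -
  have on: "finite_orthonormal F" using assms by (simp add: eigsystem_def)
  have "real (card F) * (t - 1)\<^sup>2 = (\<Sum>f\<in>F. (t - 1)\<^sup>2)" by simp
  also have "\<dots> \<le> (\<Sum>f\<in>F. (norm (S f - f))\<^sup>2)"
  proof (rule sum_mono)
    fix f assume "f \<in> F"
    then obtain s where s: "t \<le> s" "S f = s *\<^sub>R f" "norm f = 1"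
      using assms(3) by (auto simp: eigsystem_def finite_orthonormal_def)
    have "S f - f = (s - 1) *\<^sub>R f"
      using s by (simp add: algebra_simps)
    then have "norm (S f - f) = s - 1"
      using s assms(2) by simp
    then show "(t - 1)\<^sup>2 \<le> (norm (S f - f))\<^sup>2"
      using s assms(2) by (simp add: power_mono)
  qed
  also have "\<dots> \<le> C" by (rule bound[OF on])
  finally have "real (card F) \<le> C / (t - 1)\<^sup>2"
    using assms(2) by (simp add: field_simps)
  then show ?thesis by linarith
qed

text \<open>Compactness of \<open>S - I\<close> makes the supremum of the quadratic form of \<open>S\<close> on the orthogonal
  complement of \<open>F\<close> an eigenvalue as soon as it exceeds \<open>1\<close>.\<close>

lemma max_eigsystem_form_less:
  fixes S :: "'a::{real_inner, complete_space} \<Rightarrow> 'a"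
  assumes sym: "symmetric_op S"
    and bound: "\<And>F. finite_orthonormal F \<Longrightarrow> (\<Sum>f\<in>F. (norm (S f - f))\<^sup>2) \<le> C"
    and t: "1 < t" and F: "max_eigsystem S t F"
    and w: "\<And>f. f \<in> F \<Longrightarrow> w \<bullet> f = 0" "w \<noteq> 0"
  shows "S w \<bullet> w < t * (norm w)\<^sup>2"
proof (rule ccontr)
  assume "\<not> S w \<bullet> w < t * (norm w)\<^sup>2"
  then have ge: "t * (norm w)\<^sup>2 \<le> S w \<bullet> w" by simp
  have blS: "bounded_linear S" and inn: "\<And>x y. S x \<bullet> y = x \<bullet> S y"
    using sym by (auto simp: symmetric_op_def)
  interpret S: bounded_linear S by fact
  define N where "N = {u. \<forall>f\<in>F. u \<bullet> f = 0}"
  have subN: "subspace N"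
    by (auto simp: N_def subspace_def inner_simps)
  have SN: "S u \<in> N" if "u \<in> N" for u
    unfolding N_def
  proof (intro CollectI ballI)
    fix f assume f: "f \<in> F"
    then obtain s where "S f = s *\<^sub>R f"
      using F by (auto simp: max_eigsystem_def eigsystem_def)
    then show "S u \<bullet> f = 0"
      using that f by (simp add: inn N_def)
  qed
  define X where "X = (\<lambda>u. S u \<bullet> u) ` {u \<in> N. norm u = 1}"
  obtain K where K: "\<And>x. norm (S x) \<le> norm x * K"
    using S.bounded by blast
  have bdd: "bdd_above X"
  proof (rule bdd_aboveI[of _ K])
    fix x assume "x \<in> X"
    then obtain u where "norm u = 1" "x = S u \<bullet> u" by (auto simp: X_def)
    then show "x \<le> K"
      using norm_cauchy_schwarz[of "S u" u] K[of u] by simp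
  qed
  define \<mu> where "\<mu> = Sup X"
  define w1 where "w1 = w /\<^sub>R norm w"
  have w1: "w1 \<in> N" "norm w1 = 1"
    using w by (auto simp: w1_def N_def)
  have "S w1 \<bullet> w1 = (S w \<bullet> w) / (norm w)\<^sup>2"
    by (simp add: w1_def S.scaleR power2_eq_square divide_simps)
  then have tw1: "t \<le> S w1 \<bullet> w1"
    using ge w(2) by (simp add: pos_le_divide_eq)
  have w1X: "S w1 \<bullet> w1 \<in> X" using w1 by (auto simp: X_def)
  then have ne: "X \<noteq> {}" by blast
  have t\<mu>: "t \<le> \<mu>"
    unfolding \<mu>_def by (rule order_trans[OF tw1 cSup_upper[OF w1X bdd]])
  define T where "T = (\<lambda>x. \<mu> *\<^sub>R x - S x)"
  have blT: "bounded_linear T"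
    unfolding T_def by (intro bounded_linear_sub bounded_linear_scaleR_right blS)
  interpret T: bounded_linear T by fact
  have innT: "T x \<bullet> y = x \<bullet> T y" for x y
    by (simp add: T_def inner_simps inn)
  have Tpos: "0 \<le> T u \<bullet> u" if u: "u \<in> N" for u
  proof (cases "u = 0")
    case False
    define u1 where "u1 = u /\<^sub>R norm u"
    have "norm u1 = 1" "u1 \<in> N"
      using False u subN by (auto simp: u1_def subspace_scale)
    then have "S u1 \<bullet> u1 \<in> X"
      unfolding X_def by blast
    then have "S u1 \<bullet> u1 \<le> \<mu>"
      unfolding \<mu>_def by (rule cSup_upper[OF _ bdd])
    then have "(norm u)\<^sup>2 * (S u1 \<bullet> u1) \<le> (norm u)\<^sup>2 * \<mu>"
      by (rule mult_left_mono) simp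
    moreover have "S (norm u *\<^sub>R u1) \<bullet> (norm u *\<^sub>R u1) = (norm u)\<^sup>2 * (S u1 \<bullet> u1)"
      by (simp add: S.scaleR power2_eq_square)
    moreover have "norm u *\<^sub>R u1 = u"
      using False by (simp add: u1_def)
    ultimately have "S u \<bullet> u \<le> \<mu> * (norm u)\<^sup>2"
      by (simp add: mult.commute)
    then show ?thesis by (simp add: T_def inner_simps dot_square_norm)
  qed (simp add: T.zero)
  obtain L where L: "0 < L" "\<And>x. norm (T x) \<le> norm x * L"
    using T.pos_bounded by blast
  have TN: "T u \<in> N" if "u \<in> N" for u
    unfolding T_def using that SN subN by (intro subspace_diff subspace_scale)
  have "\<exists>u\<in>N. norm u = 1 \<and> \<mu> - 1 / Suc n < S u \<bullet> u" for n
    using less_cSupD[OF ne, of "\<mu> - 1 / Suc n"] by (auto simp: X_def \<mu>_def)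
  then obtain U where U: "\<And>n. U n \<in> N" "\<And>n. norm (U n) = 1" "\<And>n. \<mu> - 1 / Suc n < S (U n) \<bullet> U n"
    by metis
  \<comment> \<open>The maximizing sequence consists of approximate eigenvectors: Cauchy--Schwarz
    for the form of \<open>T\<close> on \<open>N\<close>, applied to \<open>U n\<close> and
    \<open>T (U n)\<close>, bounds \<open>T (U n)\<close> by the defect
    \<open>T (U n) \<bullet> U n\<close>, which is below \<open>1 / Suc n\<close>.\<close>
  have TU: "norm (T (U n)) \<le> sqrt (L * (1 / Suc n))" for n
  proof (cases "T (U n) = 0")
    case False
    let ?v = "T (U n)"
    have "(?v \<bullet> ?v)\<^sup>2 \<le> (?v \<bullet> U n) * (T ?v \<bullet> ?v)"
      by (rule semidefinite_cauchy_schwarz[OF T.linear_axioms subN Tpos innT U(1) TN[OF U(1)]])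
    also have "\<dots> \<le> (1 / Suc n) * (L * (norm ?v)\<^sup>2)"
    proof (rule mult_mono)
      have "U n \<bullet> U n = 1" using U(2)[of n] by (simp add: norm_eq_1)
      then show "?v \<bullet> U n \<le> 1 / Suc n"
        using U(3)[of n] by (simp add: T_def inner_simps)
      show "T ?v \<bullet> ?v \<le> L * (norm ?v)\<^sup>2"
        using norm_cauchy_schwarz[of "T ?v" ?v] mult_right_mono[OF L(2)[of ?v], of "norm ?v"]
        by (simp add: power2_eq_square mult_ac)
      show "0 \<le> T ?v \<bullet> ?v" by (rule Tpos[OF TN[OF U(1)]])
    qed simp
    finally have "(norm ?v)\<^sup>2 * (norm ?v)\<^sup>2 \<le> (L * (1 / Suc n)) * (norm ?v)\<^sup>2"
      by (simp add: dot_square_norm power2_eq_square mult_ac)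
    then have "(norm ?v)\<^sup>2 \<le> L * (1 / Suc n)"
      using False by (simp only: mult_le_cancel_right) simp
    then show ?thesis by (rule real_le_rsqrt)
  qed (use L in simp)
  have "(\<lambda>n. sqrt (L * (1 / Suc n))) \<longlonglongrightarrow> sqrt (L * 0)"
    by (intro tendsto_intros LIMSEQ_Suc[OF lim_1_over_n])
  then have T0: "(\<lambda>n. T (U n)) \<longlonglongrightarrow> 0"
    by (intro Lim_null_comparison[of "\<lambda>n. T (U n)" "\<lambda>n. sqrt (L * (1 / Suc n))"])
      (use TU in simp_all)
  have "linear (\<lambda>x. S x - x)"
    by (intro linear_compose_sub S.linear linear_ident)
  then obtain y r where r: "strict_mono r" "(\<lambda>n. S (U (r n)) - U (r n)) \<longlonglongrightarrow> y"
  proof (rule hilbert_schmidt_convergent_subsequence)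
    show "(\<Sum>f\<in>F. (norm (S f - f))\<^sup>2) \<le> C" if "finite_orthonormal F" for F
      by (rule bound[OF that])
    show "norm (U n) \<le> 1" for n
      using U(2)[of n] by simp
  qed (rule that)
  have "(\<lambda>n. T (U (r n))) \<longlonglongrightarrow> 0"
    using LIMSEQ_subseq_LIMSEQ[OF T0 r(1)] by (simp add: o_def)
  then have "(\<lambda>n. (1 / (\<mu> - 1)) *\<^sub>R (T (U (r n)) + (S (U (r n)) - U (r n)))) \<longlonglongrightarrow> (1 / (\<mu> - 1)) *\<^sub>R (0 + y)"
    by (intro tendsto_intros r(2))
  \<comment> \<open>Since \<open>\<mu> > 1\<close>, the vector \<open>U (r n)\<close> is recovered
    from \<open>T (U (r n))\<close> and its image under \<open>S - I\<close>, both of which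
    converge.\<close>
  moreover have "(1 / (\<mu> - 1)) *\<^sub>R (T x + (S x - x)) = x" for x
  proof -
    have "T x + (S x - x) = (\<mu> - 1) *\<^sub>R x" by (simp add: T_def algebra_simps)
    then show ?thesis using t t\<mu> by simp
  qed
  ultimately obtain u where u: "(\<lambda>n. U (r n)) \<longlonglongrightarrow> u"
    by auto
  have "norm u = 1"
    using tendsto_norm[OF u] U(2) by (simp add: LIMSEQ_const_iff)
  moreover have "u \<bullet> f = 0" if "f \<in> F" for f
  proof -
    have "(\<lambda>n. U (r n) \<bullet> f) \<longlonglongrightarrow> u \<bullet> f" by (intro tendsto_intros u)
    then show ?thesis using U(1) that by (simp add: N_def LIMSEQ_const_iff)
  qed
  moreover have "S u = \<mu> *\<^sub>R u"
  proof -
    have "(\<lambda>n. T (U (r n))) \<longlonglongrightarrow> T u" by (rule T.tendsto[OF u])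
    then have "T u = 0"
      using \<open>(\<lambda>n. T (U (r n))) \<longlonglongrightarrow> 0\<close> LIMSEQ_unique by blast
    then show ?thesis by (simp add: T_def)
  qed
  ultimately show False
    using max_eigsystem_orthogonal_eigenvector[OF F S.linear, of u \<mu>] t\<mu> by auto
qed

section \<open>Symplectic eigenvalues versus eigenvalues\<close>

lemma J_op_simps:
  fixes a b :: "'h::real_inner \<times> 'h"
  shows "J_op (J_op a) = - a" "J_op a \<bullet> b = - (a \<bullet> J_op b)" "J_op a \<bullet> J_op b = a \<bullet> b"
  by (auto simp: J_op_def inner_prod_def inner_commute uminus_prod_def)

lemma linear_J_op: "linear J_op"
  by (rule linearI) (auto simp: J_op_def)

text \<open>Evaluate the complex form at \<open>a + i b\<close>. The two cross terms agree because
  \<open>J_op\<close> is antisymmetric.\<close>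

lemma cpositive_imp_J_op_le:
  assumes "cpositive (\<lambda>w. complexify S w - cscale \<i> (complexify J_op w))"
  shows "2 * (J_op a \<bullet> b) \<le> S a \<bullet> a + S b \<bullet> b"
proof -
  have "0 \<le> Re (cinner (complexify S (a, b) - cscale \<i> (complexify J_op (a, b))) (a, b))"
    using assms unfolding cpositive_def by blast
  also have "\<dots> = S a \<bullet> a + S b \<bullet> b + J_op b \<bullet> a - J_op a \<bullet> b"
    by (simp add: cinner_def complexify_def cscale_def inner_simps)
  also have "J_op b \<bullet> a = - (J_op a \<bullet> b)"
    using J_op_simps(2)[of b a] by (simp add: inner_commute)
  finally show ?thesis by simp
qed

lemma williamson_form_inner:
  fixes S :: "'h::{real_inner, complete_space} \<times> 'h \<Rightarrow> 'h \<times> 'h"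
  assumes "williamson_form S D M"
  shows "S a \<bullet> b = map_prod D D (M a) \<bullet> M b"
proof -
  have "bounded_linear M" "S = adjoint M \<circ> map_prod D D \<circ> M"
    using assms by (auto simp: williamson_form_def symplectic_transformation_def)
  then show ?thesis
    using adjoint_inner[of M b "map_prod D D (M a)"] by (simp add: inner_commute)
qed

text \<open>The second identity says that the transpose of \<open>M\<close> is symplectic as well.
  It follows from the defining identity because \<open>M\<close> is onto.\<close>

lemma symplectic_transformation_J_op:
  fixes M :: "'h::{real_inner, complete_space} \<times> 'h \<Rightarrow> 'h \<times> 'h"
  assumes M: "symplectic_transformation M"
  shows "J_op (M a) \<bullet> M b = J_op a \<bullet> b" "M (J_op (adjoint M x)) = J_op x"
proof -
  have bl: "bounded_linear M" and comp: "adjoint M \<circ> J_op \<circ> M = J_op"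
    using M by (auto simp: symplectic_transformation_def)
  have eq: "adjoint M (J_op (M a)) = J_op a" for a
    using fun_cong[OF comp, of a] by simp
  then show "J_op (M a) \<bullet> M b = J_op a \<bullet> b"
    using adjoint_inner[OF bl, of b "J_op (M a)"] by (simp add: inner_commute)
  obtain R where R: "\<And>x. M (R x) = x"
    using M by (auto simp: symplectic_transformation_def invertible_op_def fun_eq_iff)
  interpret M: bounded_linear M by (rule bl)
  have J: "J_op (- x) = - J_op x" for x :: "'h \<times> 'h"
    by (simp add: J_op_def)
  \<comment> \<open>The choice gives \<open>M a = - J_op x\<close>, hence
    \<open>x = J_op (M a)\<close>, to which \<open>eq\<close> applies.\<close>
  define a where "a = R (- J_op x)"
  have "x = J_op (M a)"
    by (simp add: a_def R J J_op_simps(1))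
  then have "M (J_op (adjoint M x)) = - M a"
    by (simp add: eq J_op_simps(1) M.neg)
  then show "M (J_op (adjoint M x)) = J_op x"
    by (simp add: a_def R)
qed

text \<open>The hypothesis \<open>J\<close> is tested on the preimages under \<open>M\<close> of
  \<open>(x, 0)\<close> and \<open>J_op (x, 0) = (0, - x)\<close>. As \<open>M\<close> preserves the
  symplectic form, the left side becomes \<open>2 * (norm x)\<^sup>2\<close>, while the right side
  becomes twice the form of \<open>D\<close>.\<close>

lemma symplectic_spectrum_ge_one:
  fixes S :: "'h::{real_inner, complete_space} \<times> 'h \<Rightarrow> 'h \<times> 'h"
  assumes J: "\<And>a b. 2 * (J_op a \<bullet> b) \<le> S a \<bullet> a + S b \<bullet> b" and W: "williamson_form S D M"
  shows "(norm x)\<^sup>2 \<le> D x \<bullet> x"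
proof -
  have M: "symplectic_transformation M" and "bounded_linear D"
    using W by (auto simp: williamson_form_def positive_op_def symmetric_op_def)
  then interpret D: bounded_linear D by blast
  obtain R where R: "\<And>x. M (R x) = x"
    using M by (auto simp: symplectic_transformation_def invertible_op_def fun_eq_iff)
  let ?a = "R (x, 0)" and ?b = "R (0, - x)"
  have "2 * (norm x)\<^sup>2 = 2 * (J_op (M ?a) \<bullet> M ?b)"
    by (simp add: R J_op_def inner_prod_def dot_square_norm)
  also have "\<dots> \<le> S ?a \<bullet> ?a + S ?b \<bullet> ?b"
    using J[of ?a ?b] by (simp add: symplectic_transformation_J_op(1)[OF M])
  also have "\<dots> = 2 * (D x \<bullet> x)"
    unfolding williamson_form_inner[OF W] R by (simp add: inner_prod_def D.zero D.neg)
  finally show ?thesis by simp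
qed

section \<open>Dimension comparison between eigenvectors of \<open>D\<close> and of
  \<open>S\<close>\<close>

lemma linear_adjoint:
  fixes A :: "'a::{real_inner, complete_space} \<Rightarrow> 'b::real_inner"
  assumes "bounded_linear A"
  shows "linear (adjoint A)"
proof (rule linearI)
  have *: "x = y" if "\<And>z. z \<bullet> x = z \<bullet> y" for x y :: 'a
    using that vector_eq_ldot by blast
  show "adjoint A (x + y) = adjoint A x + adjoint A y" for x y
    by (rule *) (simp add: inner_add_right flip: adjoint_inner[OF assms])
  show "adjoint A (c *\<^sub>R x) = c *\<^sub>R adjoint A x" for c x
    by (rule *) (simp flip: adjoint_inner[OF assms])
qed

lemma finite_orthonormal_inner_expand:
  assumes "finite_orthonormal F" "x \<in> span F"
  shows "x \<bullet> y = (\<Sum>v\<in>F. (x \<bullet> v) * (y \<bullet> v))"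
proof -
  have "x = proj_on F x"
    using diff_proj_on_le[OF assms, of x] by simp
  then have "x \<bullet> y = proj_on F x \<bullet> y" by simp
  also have "\<dots> = (\<Sum>v\<in>F. (x \<bullet> v) * (v \<bullet> y))"
    by (simp only: proj_on_def inner_sum_left inner_scaleR_left)
  finally show ?thesis
    by (simp add: inner_commute[of y])
qed

text \<open>On \<open>span G\<close> the operator \<open>D\<close> is diagonal with entries
  \<open>s v\<close> at least \<open>t\<close>, so \<open>t * s v\<close> is at most the square of
  \<open>s v\<close>.\<close>

lemma eigsystem_span_form_le:
  assumes G: "eigsystem D t G" and symD: "symmetric_op D" and "0 \<le> t" and u: "u \<in> span G"
  shows "t * (D u \<bullet> u) \<le> (norm (D u))\<^sup>2"
proof -
  have on: "finite_orthonormal G" using G by (simp add: eigsystem_def)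
  have "linear D" and inn: "\<And>x y. D x \<bullet> y = x \<bullet> D y"
    using symD by (auto simp: symmetric_op_def bounded_linear.linear)
  obtain s where s: "\<And>v. v \<in> G \<Longrightarrow> t \<le> s v" "\<And>v. v \<in> G \<Longrightarrow> D v = s v *\<^sub>R v"
    using G unfolding eigsystem_def by metis
  have "D ` G \<subseteq> span G"
    using s(2) by (auto intro: span_scale span_base)
  then have Du: "D u \<in> span G"
    using u linear_span_image[OF \<open>linear D\<close>, of G] span_minimal[OF _ subspace_span] by blast
  have Dv: "D u \<bullet> v = s v * (u \<bullet> v)" if "v \<in> G" for v
    using inn[of u v] s(2)[OF that] by simp
  have "D u \<bullet> u = (\<Sum>v\<in>G. s v * (u \<bullet> v)\<^sup>2)"
    by (rule trans[OF finite_orthonormal_inner_expand[OF on Du] sum.cong])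
      (simp_all add: Dv power2_eq_square)
  then have "t * (D u \<bullet> u) = (\<Sum>v\<in>G. t * (s v * (u \<bullet> v)\<^sup>2))"
    by (simp only: sum_distrib_left)
  also have "\<dots> \<le> (\<Sum>v\<in>G. s v * (s v * (u \<bullet> v)\<^sup>2))"
  proof (rule sum_mono)
    fix v assume "v \<in> G"
    then have "t \<le> s v" "0 \<le> s v" using s(1) \<open>0 \<le> t\<close> by (auto intro: order_trans)
    then show "t * (s v * (u \<bullet> v)\<^sup>2) \<le> s v * (s v * (u \<bullet> v)\<^sup>2)"
      by (intro mult_right_mono mult_nonneg_nonneg) simp_all
  qed
  also have "\<dots> = D u \<bullet> D u"
    by (rule sym[OF trans[OF finite_orthonormal_inner_expand[OF on Du] sum.cong]])
      (simp_all add: Dv power2_eq_square)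
  finally show ?thesis by (simp add: power2_norm_eq_inner)
qed

text \<open>For orthonormal \<open>G\<close> this is an orthonormal basis of
  \<open>span G \<oplus> span G\<close>. It serves both for the vectors \<open>u\<close> built from
  eigenvectors of \<open>D\<close> and for pairs of vectors in the span of eigenvectors of
  \<open>S\<close>.\<close>

definition double_set :: "'a::real_vector set \<Rightarrow> ('a \<times> 'a) set" where
  "double_set G = (\<lambda>v. (v, 0)) ` G \<union> (\<lambda>v. (0, v)) ` G"

lemma finite_orthonormal_double_set:
  fixes G :: "'a::real_inner set"
  assumes "finite_orthonormal G"
  shows "finite_orthonormal (double_set G)" "card (double_set G) = 2 * card G"
proof -
  have "v \<noteq> 0" if "v \<in> G" for v
    using assms that by (auto simp: finite_orthonormal_def)
  then have "(\<lambda>v. (v, 0::'a)) ` G \<inter> (\<lambda>v. (0::'a, v)) ` G = {}"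
    by auto
  moreover have "finite G" using assms by (simp add: finite_orthonormal_def)
  ultimately show "card (double_set G) = 2 * card G"
    unfolding double_set_def by (subst card_Un_disjoint) (auto simp: card_image inj_on_def)
  show "finite_orthonormal (double_set G)"
    using assms unfolding finite_orthonormal_def double_set_def pairwise_def orthogonal_def
    by (auto simp: finite_orthonormal_inner[OF assms] norm_Pair split: if_splits)
qed

lemma span_double_set:
  fixes w :: "'a::real_vector \<times> 'a"
  shows "w \<in> span (double_set G) \<longleftrightarrow> fst w \<in> span G \<and> snd w \<in> span G"
proof
  assume "w \<in> span (double_set G)"
  then show "fst w \<in> span G \<and> snd w \<in> span G"
  proof (induction rule: span_induct_alt)
    case (step c x y)
    then show ?case
      by (auto simp: double_set_def intro!: span_add span_scale intro: span_base span_zero)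
  qed (simp add: span_zero)
next
  have base: "(v, 0) \<in> span (double_set G)" "(0, v) \<in> span (double_set G)" if "v \<in> G" for v
    using that by (auto simp: double_set_def intro!: span_base)
  have "(a, 0) \<in> span (double_set G) \<and> (0, a) \<in> span (double_set G)" if "a \<in> span G" for a
    using that
  proof (induction rule: span_induct_alt)
    case base
    then show ?case using span_zero[of "double_set G"] unfolding zero_prod_def by simp
  next
    case (step c v a)
    have "c *\<^sub>R (v, 0) + (a, 0) \<in> span (double_set G)" "c *\<^sub>R (0, v) + (0, a) \<in> span (double_set G)"
      using step base by (blast intro: span_add span_scale)+
    then show ?case by simp
  qed
  moreover assume "fst w \<in> span G \<and> snd w \<in> span G"
  ultimately have "(fst w, 0) \<in> span (double_set G)" "(0, snd w) \<in> span (double_set G)"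
    by blast+
  then have "(fst w, 0) + (0, snd w) \<in> span (double_set G)"
    by (rule span_add)
  then show "w \<in> span (double_set G)" by simp
qed

text \<open>For \<open>p = (D \<oplus> D) u\<close> the pair \<open>(M\<^sup>T p, M\<^sup>T J p)\<close> is the image under \<open>M\<^sup>T\<close> of
  \<open>p + i J p\<close>, an eigenvector of \<open>i J\<close> for the eigenvalue \<open>1\<close>; hence \<open>i J \<le> I\<close> bounds its norm from
  below, as \<open>M\<^sup>T\<close> is symplectic.\<close>

lemma symplectic_form_ge:
  fixes S :: "'h::{real_inner, complete_space} \<times> 'h \<Rightarrow> 'h \<times> 'h"
  assumes W: "williamson_form S D M" and D1: "\<And>x. (norm x)\<^sup>2 \<le> D x \<bullet> x"
    and t: "0 < t" and u: "t * (map_prod D D u \<bullet> u) \<le> (norm (map_prod D D u))\<^sup>2" "u \<noteq> 0"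
  defines "w1 \<equiv> adjoint M (map_prod D D u)" and "w2 \<equiv> adjoint M (map_prod D D (J_op u))"
  shows "0 < (norm w1)\<^sup>2 + (norm w2)\<^sup>2"
    "t * ((norm w1)\<^sup>2 + (norm w2)\<^sup>2) \<le> S w1 \<bullet> w1 + S w2 \<bullet> w2"
proof -
  have M: "symplectic_transformation M" and blM: "bounded_linear M" and blD: "bounded_linear D"
    and inn: "\<And>x y. D x \<bullet> y = x \<bullet> D y"
    using W by (auto simp: williamson_form_def symplectic_transformation_def positive_op_def symmetric_op_def)
  interpret D: bounded_linear D by (rule blD)
  let ?D = "map_prod D D"
  have linD: "linear ?D"
    by (rule linearI) (simp_all add: prod_eq_iff D.add D.scaleR)
  have innD: "?D x \<bullet> y = x \<bullet> ?D y" for x y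
    by (simp add: inner_prod_def inn)
  have D1': "(norm x)\<^sup>2 \<le> ?D x \<bullet> x" for x
    using D1[of "fst x"] D1[of "snd x"]
    by (simp add: inner_prod_def norm_prod_def)
  have posD: "0 \<le> ?D x \<bullet> x" for x
    using D1'[of x] by (meson order_trans zero_le_power2)
  have DJ: "?D (J_op x) = J_op (?D x)" for x
    by (simp add: J_op_def prod_eq_iff D.neg)
  \<comment> \<open>Moving \<open>adjoint M\<close> across gives
    \<open>(norm ?w)\<^sup>2 = ?D (M ?w) \<bullet> x\<close>. Cauchy--Schwarz for the form of
    \<open>?D\<close> applies to this, and the form of \<open>?D\<close> at \<open>M ?w\<close> is
    that of \<open>S\<close> at \<open>?w\<close>.\<close>
  have CS: "((norm (adjoint M (?D x)))\<^sup>2)\<^sup>2 \<le> (S (adjoint M (?D x)) \<bullet> adjoint M (?D x)) * (?D x \<bullet> x)" for x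
  proof -
    let ?w = "adjoint M (?D x)"
    have "(norm ?w)\<^sup>2 = ?D (M ?w) \<bullet> x"
      using adjoint_inner[OF blM, of ?w "?D x"] by (simp add: innD power2_norm_eq_inner)
    then show ?thesis
      using semidefinite_cauchy_schwarz[OF linD subspace_UNIV posD innD UNIV_I UNIV_I, of "M ?w" x]
      by (simp add: williamson_form_inner[OF W])
  qed
  define q where "q = ?D u \<bullet> u"
  define a where "a = (norm w1)\<^sup>2"
  define b where "b = (norm w2)\<^sup>2"
  have q: "0 < q"
    using D1'[of u] u(2) unfolding q_def by (metis less_le_trans zero_less_norm_iff zero_less_power)
  have "?D (J_op u) \<bullet> J_op u = q"
    by (simp add: DJ J_op_simps(3) q_def)
  then have CSab: "a\<^sup>2 \<le> (S w1 \<bullet> w1) * q" "b\<^sup>2 \<le> (S w2 \<bullet> w2) * q"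
    using CS[of u] CS[of "J_op u"] by (simp_all add: q_def a_def b_def w1_def w2_def)
  \<comment> \<open>The symplectic pairing of \<open>w1\<close> and \<open>w2\<close> equals
    \<open>(norm (?D u))\<^sup>2\<close>, and it is at most half of \<open>a + b\<close>. Together
    these give the lower bound \<open>tq\<close>.\<close>
  have "J_op w1 \<bullet> w2 = M (J_op w1) \<bullet> ?D (J_op u)"
    unfolding w2_def by (rule adjoint_inner[OF blM, symmetric])
  also have "\<dots> = J_op (?D u) \<bullet> J_op (?D u)"
    unfolding w1_def DJ symplectic_transformation_J_op(2)[OF M] ..
  also have "\<dots> = (norm (?D u))\<^sup>2"
    by (simp add: J_op_simps(3) power2_norm_eq_inner)
  finally have "t * q \<le> J_op w1 \<bullet> w2"
    using u(1) by (simp add: q_def)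
  moreover have "0 \<le> (norm (J_op w1 - w2))\<^sup>2" by simp
  then have "2 * (J_op w1 \<bullet> w2) \<le> a + b"
    unfolding a_def b_def power2_norm_eq_inner
    by (simp add: inner_simps J_op_simps(3) inner_commute)
  ultimately have tq: "2 * (t * q) \<le> a + b" by linarith
  then have pos: "0 < a + b"
    using t q by (meson less_le_trans mult_pos_pos zero_less_numeral)
  then show "0 < (norm w1)\<^sup>2 + (norm w2)\<^sup>2" by (simp add: a_def b_def)
  \<comment> \<open>Multiplying \<open>tq\<close> by \<open>a + b\<close> and bounding the square by
    \<open>2 * (a\<^sup>2 + b\<^sup>2)\<close> brings in \<open>CSab\<close>; the common factor
    \<open>2 * q\<close> then cancels.\<close>
  have "(2 * (t * q)) * (a + b) \<le> (a + b) * (a + b)"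
    using tq pos by (intro mult_right_mono) auto
  also have "\<dots> \<le> 2 * (a\<^sup>2 + b\<^sup>2)"
    using zero_le_power2[of "a - b"] by (simp add: power2_eq_square algebra_simps)
  also have "\<dots> \<le> 2 * ((S w1 \<bullet> w1 + S w2 \<bullet> w2) * q)"
    using CSab by (simp add: algebra_simps)
  also have "(2 * (t * q)) * (a + b) = 2 * ((t * (a + b)) * q)"
    by simp
  finally have "(t * (a + b)) * q \<le> (S w1 \<bullet> w1 + S w2 \<bullet> w2) * q"
    by linarith
  then show "t * ((norm w1)\<^sup>2 + (norm w2)\<^sup>2) \<le> S w1 \<bullet> w1 + S w2 \<bullet> w2"
    using q by (simp add: a_def b_def)
qed

text \<open>The map \<open>L\<close> projects the pair \<open>(w1 u, w2 u)\<close> onto the span of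
  \<open>F\<close>. On its kernel both vectors are orthogonal to \<open>F\<close>, where
  \<open>less\<close> contradicts \<open>symplectic_form_ge\<close>; so \<open>L\<close> is
  injective on a space of dimension \<open>2 * card G\<close> with values in one of dimension
  \<open>2 * card F\<close>.\<close>

lemma symplectic_eigsystem_card_le:
  fixes S :: "'h::{real_inner, complete_space} \<times> 'h \<Rightarrow> 'h \<times> 'h"
  assumes W: "williamson_form S D M" and D1: "\<And>x. (norm x)\<^sup>2 \<le> D x \<bullet> x" and t: "0 < t"
    and F: "finite_orthonormal F"
    and less: "\<And>w. (\<And>f. f \<in> F \<Longrightarrow> w \<bullet> f = 0) \<Longrightarrow> w \<noteq> 0 \<Longrightarrow> S w \<bullet> w < t * (norm w)\<^sup>2"
    and G: "eigsystem D t G"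
  shows "card G \<le> card F"
proof -
  have blM: "bounded_linear M" and sym: "symmetric_op D"
    using W by (auto simp: williamson_form_def symplectic_transformation_def positive_op_def)
  then have blD: "bounded_linear D" by (simp add: symmetric_op_def)
  interpret D: bounded_linear D by (rule blD)
  have on: "finite_orthonormal G" using G by (simp add: eigsystem_def)
  let ?D = "map_prod D D"
  have linD: "linear ?D"
    by (rule linearI) (simp_all add: prod_eq_iff D.add D.scaleR)
  have linA: "linear (adjoint M)"
    by (rule linear_adjoint[OF blM])
  define w1 where "w1 u = adjoint M (?D u)" for u
  define w2 where "w2 u = adjoint M (?D (J_op u))" for u
  define L where "L u = (proj_on F (w1 u), proj_on F (w2 u))" for u
  have "linear (proj_on F)"
    by (rule linearI) (auto simp: proj_on_def inner_simps scaleR_add_left sum.distrib scaleR_sum_right)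
  then have "linear (proj_on F \<circ> (adjoint M \<circ> ?D))" "linear (proj_on F \<circ> (adjoint M \<circ> (?D \<circ> J_op)))"
    by (intro linear_compose linD linA linear_J_op; assumption)+
  then have "linear (\<lambda>u. proj_on F (w1 u))" "linear (\<lambda>u. proj_on F (w2 u))"
    by (simp_all add: o_def w1_def w2_def)
  note lin = this[THEN linear_add] this[THEN linear_scale]
  have linL: "linear L"
    unfolding L_def by (rule linearI) (simp_all add: lin)
  have ge: "t * (?D u \<bullet> u) \<le> (norm (?D u))\<^sup>2" if "u \<in> span (double_set G)" for u
    using that eigsystem_span_form_le[OF G sym less_imp_le[OF t]]
    by (simp add: span_double_set inner_prod_def norm_prod_def distrib_left add_mono)
  have inj: "inj_on L (span (double_set G))"
    unfolding linear_injective_on_subspace_0[OF linL subspace_span]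
  proof (intro ballI impI, rule ccontr)
    fix u assume u: "u \<in> span (double_set G)" "L u = 0" "u \<noteq> 0"
    note * = symplectic_form_ge[OF W D1 t ge[OF u(1)] u(3), folded w2_def, folded w1_def]
    have "w1 u \<bullet> f = 0" "w2 u \<bullet> f = 0" if "f \<in> F" for f
    proof -
      have "proj_on F (w1 u) = 0" "proj_on F (w2 u) = 0"
        using u(2) by (simp_all add: L_def prod_eq_iff)
      then show "w1 u \<bullet> f = 0" "w2 u \<bullet> f = 0"
        using proj_on_inner[OF F that, of "w1 u"] proj_on_inner[OF F that, of "w2 u"] by simp_all
    qed
    from less[OF this(1)] less[OF this(2)]
    have "S (w1 u) \<bullet> w1 u < t * (norm (w1 u))\<^sup>2 \<or> w1 u = 0"
      "S (w2 u) \<bullet> w2 u < t * (norm (w2 u))\<^sup>2 \<or> w2 u = 0"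
      by blast+
    \<comment> \<open>One of the two vectors may vanish, but not both by the first part of
      \<open>*\<close>, so the summed inequality is still strict.\<close>
    then show False
      using * by (auto simp: distrib_left)
  qed
  have "L ` double_set G \<subseteq> span (double_set F)"
    by (auto simp: L_def span_double_set proj_on_span)
  moreover have "independent (L ` double_set G)"
    by (rule linear_independent_injective_image[OF linL _ inj])
      (rule finite_orthonormal_independent[OF finite_orthonormal_double_set(1)[OF on]])
  moreover have "finite (double_set F)"
    using finite_orthonormal_double_set(1)[OF F] by (simp add: finite_orthonormal_def)
  ultimately have "card (L ` double_set G) \<le> card (double_set F)"
    using independent_span_bound by blast
  moreover have "card (L ` double_set G) = card (double_set G)"
    by (rule card_image[OF inj_on_subset[OF inj span_superset]])
  ultimately show ?thesis
    using finite_orthonormal_double_set(2)[OF on] finite_orthonormal_double_set(2)[OF F] by simp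
qed

section \<open>Decreasing arrangements\<close>

lemma down_closed_eq_atLeastAtMost:
  fixes U :: "nat set"
  assumes "finite U" "0 \<notin> U" and down: "\<And>i k. i \<in> U \<Longrightarrow> 1 \<le> k \<Longrightarrow> k \<le> i \<Longrightarrow> k \<in> U"
  shows "U = {1..card U}"
proof (cases "U = {}")
  case False
  have "U = {1..Max U}"
  proof (intro equalityI subsetI)
    fix i assume "i \<in> U"
    then have "i \<le> Max U" "i \<noteq> 0" using assms(1,2) by (simp, metis)
    then show "i \<in> {1..Max U}" by simp
  next
    fix i assume "i \<in> {1..Max U}"
    then show "i \<in> U" using down[OF Max_in[OF assms(1) False], of i] by simp
  qed
  moreover from this have "card U = card {1..Max U}" by (rule arg_cong)
  then have "card U = Max U" by simp
  ultimately show ?thesis by (simp only:)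
qed simp

lemma eigs_above_mono: "t \<le> s \<Longrightarrow> eigs_above A s \<subseteq> eigs_above A t"
  by (auto simp: eigs_above_def)

text \<open>Reduces a possibly infinite count to finite ones: any \<open>j\<close> pairs lie above
  the smallest of their eigenvalues, which still exceeds \<open>1\<close>.\<close>

lemma num_right_eigs_ge_iff:
  assumes fin: "\<And>t. 1 < t \<Longrightarrow> finite (eigs_above A t)" and j: "1 \<le> j"
  shows "enat j \<le> num_right_eigs A \<longleftrightarrow> (\<exists>t>1. j \<le> card (eigs_above A t))"
proof -
  define P where "P = {(t::real, k::nat). 1 < t \<and> enat k < multiplicity_eig A (of_real t)}"
  have num: "num_right_eigs A = ecard P"
    by (simp add: num_right_eigs_def P_def)
  show ?thesis
  proof
    assume "enat j \<le> num_right_eigs A"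
    then have "\<exists>Q. Q \<subseteq> P \<and> finite Q \<and> card Q = j"
    proof (cases "finite P")
      case True
      then have "j \<le> card P"
        using \<open>enat j \<le> num_right_eigs A\<close> by (simp add: num ecard_def)
      then show ?thesis by (meson obtain_subset_with_card_n)
    next
      case False
      then show ?thesis by (meson infinite_arbitrarily_large)
    qed
    then obtain Q where Q: "Q \<subseteq> P" "finite Q" "card Q = j" by blast
    define t where "t = Min (fst ` Q)"
    have "Q \<noteq> {}" using Q j by auto
    then have "t \<in> fst ` Q" unfolding t_def using Q by (intro Min_in) auto
    then have t: "1 < t" using Q by (auto simp: P_def)
    have "Q \<subseteq> eigs_above A t"
    proof
      fix q assume q: "q \<in> Q"
      then have "t \<le> fst q" unfolding t_def using Q by (intro Min_le) auto
      then show "q \<in> eigs_above A t" using q Q by (auto simp: P_def eigs_above_def)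
    qed
    then have "j \<le> card (eigs_above A t)"
      using card_mono[OF fin[OF t]] Q by blast
    with t show "\<exists>t>1. j \<le> card (eigs_above A t)" by blast
  next
    assume "\<exists>t>1. j \<le> card (eigs_above A t)"
    then obtain t where t: "1 < t" "j \<le> card (eigs_above A t)" by blast
    have "eigs_above A t \<subseteq> P" using t by (auto simp: eigs_above_def P_def)
    then have "finite P \<Longrightarrow> j \<le> card P" using card_mono t(2) order_trans by blast
    then show "enat j \<le> num_right_eigs A" by (auto simp: num ecard_def)
  qed
qed

text \<open>The counting function determines the arrangement. The indices \<open>U\<close> with
  value at least \<open>t\<close> form an initial segment by monotonicity, and counting them level
  by level gives the cardinality of \<open>eigs_above A t\<close>.\<close>

lemma decreasing_right_eigs_ge_iff:
  assumes fin: "\<And>t. 1 < t \<Longrightarrow> finite (eigs_above A t)"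
    and f: "decreasing_right_eigs A f"
    and j: "1 \<le> j" "enat j \<le> num_right_eigs A" and t: "1 < t"
  shows "t \<le> f j \<longleftrightarrow> j \<le> card (eigs_above A t)"
proof -
  define I where "I = {j. 1 \<le> j \<and> enat j \<le> num_right_eigs A}"
  define L where "L s = {i \<in> I. f i = s}" for s
  have dec: "\<And>i k. i \<in> I \<Longrightarrow> k \<in> I \<Longrightarrow> i \<le> k \<Longrightarrow> f k \<le> f i"
    and lev: "\<And>s. 1 < s \<Longrightarrow> ecard (L s) = multiplicity_eig A (of_real s)"
    using f unfolding decreasing_right_eigs_def Let_def I_def[symmetric] L_def by blast+
  have L: "finite (L s)" "multiplicity_eig A (of_real s) = enat (card (L s))" if s: "t \<le> s" for s
  proof -
    have "1 < s" using s t by simp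
    show "finite (L s)"
    proof (rule ccontr)
      assume "infinite (L s)"
      then have "multiplicity_eig A (of_real s) = \<infinity>"
        using lev[OF \<open>1 < s\<close>] by (simp add: ecard_def)
      then have "range (Pair s) \<subseteq> eigs_above A t"
        using s by (auto simp: eigs_above_def)
      then have "finite (range (Pair s :: nat \<Rightarrow> _))"
        using fin[OF t] finite_subset by blast
      then show False
        using finite_imageD[of "Pair s" "UNIV :: nat set"] by (auto simp: inj_on_def)
    qed
    then show "multiplicity_eig A (of_real s) = enat (card (L s))"
      using lev[OF \<open>1 < s\<close>] by (simp add: ecard_def)
  qed
  define T where "T = fst ` eigs_above A t"
  have finT: "finite T" using fin[OF t] by (simp add: T_def)
  have T: "t \<le> s" if "s \<in> T" for s
    using that by (auto simp: T_def eigs_above_def)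
  have eq: "eigs_above A t = (SIGMA s:T. {..<card (L s)})"
  proof (intro set_eqI)
    fix p :: "real \<times> nat"
    obtain s k where p: "p = (s, k)" by fastforce
    have "p \<in> eigs_above A t \<longleftrightarrow> t \<le> s \<and> k < card (L s)"
      unfolding p by (cases "t \<le> s") (simp_all add: eigs_above_def L)
    moreover have "p \<in> eigs_above A t \<Longrightarrow> s \<in> T"
      by (force simp: p T_def)
    ultimately show "p \<in> eigs_above A t \<longleftrightarrow> p \<in> (SIGMA s:T. {..<card (L s)})"
      using T by (auto simp: p)
  qed
  define U where "U = {i \<in> I. t \<le> f i}"
  have U: "U = (\<Union>s\<in>T. L s)"
  proof (intro equalityI subsetI)
    fix i assume i: "i \<in> U"
    then have "i \<in> L (f i)" "t \<le> f i" by (auto simp: U_def L_def)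
    then have "0 < card (L (f i))"
      using L(1) by (auto simp: card_gt_0_iff)
    then have "(f i, 0) \<in> eigs_above A t"
      using L(2)[OF \<open>t \<le> f i\<close>] \<open>t \<le> f i\<close> by (simp add: eigs_above_def zero_enat_def)
    then have "f i \<in> T" by (force simp: T_def)
    then show "i \<in> (\<Union>s\<in>T. L s)" using \<open>i \<in> L (f i)\<close> by blast
  qed (auto simp: U_def L_def dest: T)
  have finU: "finite U" unfolding U using finT L(1) T by blast
  have "card U = (\<Sum>s\<in>T. card (L s))"
    unfolding U using finT L(1) T by (intro card_UN_disjoint) (auto simp: L_def)
  also have "\<dots> = card (eigs_above A t)"
    unfolding eq using finT by simp
  finally have cardU: "card U = card (eigs_above A t)" .
  have "U = {1..card U}"
  proof (rule down_closed_eq_atLeastAtMost[OF finU])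
    show "0 \<notin> U" by (simp add: U_def I_def)
    fix i k assume ik: "i \<in> U" "1 \<le> k" "k \<le> i"
    then have "k \<in> I"
      by (auto simp: U_def I_def intro: order_trans[of "enat k" "enat i"])
    then show "k \<in> U"
      using ik dec[of k i] by (auto simp: U_def)
  qed
  then have "j \<in> U \<longleftrightarrow> j \<le> card (eigs_above A t)"
    using j(1) cardU by auto
  then show ?thesis using j by (simp add: U_def I_def)
qed

text \<open>\<open>right_eig\<close> is defined by choice, so an arrangement must be exhibited. Take
  for \<open>f j\<close> the largest eigenvalue \<open>s\<close> such that at least \<open>j\<close>
  eigenvalues, with multiplicity, are at least \<open>s\<close>.\<close>

lemma decreasing_right_eigs_exists:
  assumes fin: "\<And>t. 1 < t \<Longrightarrow> finite (eigs_above A t)"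
  shows "\<exists>f. decreasing_right_eigs A f"
proof -
  define I where "I = {j. 1 \<le> j \<and> enat j \<le> num_right_eigs A}"
  define N where "N t = card (eigs_above A t)" for t
  define Q where "Q = {t::real. 1 < t \<and> 0 < multiplicity_eig A (of_real t)}"
  have I_iff: "j \<in> I \<longleftrightarrow> 1 \<le> j \<and> (\<exists>t>1. j \<le> N t)" for j
    unfolding I_def N_def using num_right_eigs_ge_iff[OF fin, of j] by auto
  have N_mono: "N s \<le> N t" if "1 < t" "t \<le> s" for s t
    unfolding N_def by (intro card_mono fin that eigs_above_mono)
  have fst_Q: "fst p \<in> Q \<and> t \<le> fst p" if "p \<in> eigs_above A t" "1 < t" for p t
    using that by (auto simp: eigs_above_def Q_def intro: order_le_less_trans[OF zero_le])
  have Q_fst: "t \<in> fst ` eigs_above A s" if "t \<in> Q" "s \<le> t" for s t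
  proof (rule image_eqI)
    show "(t, 0) \<in> eigs_above A s"
      using that by (simp add: Q_def eigs_above_def zero_enat_def)
  qed simp
  \<comment> \<open>A threshold can be raised to the least eigenvalue above it without losing any
    pair.\<close>
  have attain: "\<exists>s\<in>Q. t \<le> s \<and> j \<le> N s" if "1 < t" "1 \<le> j" "j \<le> N t" for t j
  proof -
    let ?E = "fst ` eigs_above A t"
    have E: "finite ?E" "?E \<noteq> {}"
      using fin[OF that(1)] that by (auto simp: N_def)
    then have "Min ?E \<in> ?E" by (rule Min_in)
    then obtain p where p: "p \<in> eigs_above A t" "Min ?E = fst p" by blast
    have "eigs_above A t \<subseteq> eigs_above A (fst p)"
    proof
      fix q assume q: "q \<in> eigs_above A t"
      then have "fst p \<le> fst q" unfolding p(2)[symmetric] using E by (intro Min_le) auto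
      then show "q \<in> eigs_above A (fst p)" using q by (auto simp: eigs_above_def)
    qed
    moreover have "fst p \<in> Q" "t \<le> fst p" using fst_Q[OF p(1) that(1)] by auto
    moreover have "finite (eigs_above A (fst p))"
      using fst_Q[OF p(1) that(1)] by (intro fin) (simp add: Q_def)
    ultimately show ?thesis
      using that(3) card_mono unfolding N_def by (meson order_trans)
  qed
  have "\<forall>j\<in>I. \<exists>t. t \<in> Q \<and> j \<le> N t \<and> (\<forall>s\<in>Q. j \<le> N s \<longrightarrow> s \<le> t)"
  proof
    fix j assume "j \<in> I"
    then obtain t0 where t0: "t0 \<in> Q" "j \<le> N t0" using I_iff attain by blast
    \<comment> \<open>Discarding candidates below the known solution \<open>t0\<close> leaves
      finitely many, so a maximum exists.\<close>
    let ?X = "{t \<in> Q. j \<le> N t \<and> t0 \<le> t}"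
    have "?X \<subseteq> fst ` eigs_above A t0" using Q_fst by blast
    moreover have "finite (eigs_above A t0)" using t0 by (intro fin) (simp add: Q_def)
    ultimately have X: "finite ?X" "?X \<noteq> {}" using t0 finite_subset by blast+
    have "Max ?X \<in> ?X" by (rule Max_in[OF X])
    moreover have "s \<le> Max ?X" if "s \<in> Q" "j \<le> N s" for s
    proof (cases "t0 \<le> s")
      case True
      then show ?thesis using X that by (intro Max_ge) auto
    next
      case False
      then show ?thesis using calculation by auto
    qed
    ultimately show "\<exists>t. t \<in> Q \<and> j \<le> N t \<and> (\<forall>s\<in>Q. j \<le> N s \<longrightarrow> s \<le> t)" by blast
  qed
  from bchoice[OF this] obtain f where f: "\<And>j. j \<in> I \<Longrightarrow> f j \<in> Q" "\<And>j. j \<in> I \<Longrightarrow> j \<le> N (f j)"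
    "\<And>j s. j \<in> I \<Longrightarrow> s \<in> Q \<Longrightarrow> j \<le> N s \<Longrightarrow> s \<le> f j"
    by blast
  have f1: "1 < f j" if "j \<in> I" for j
    using f(1)[OF that] by (simp add: Q_def)
  have ge: "t \<le> f j \<longleftrightarrow> j \<le> N t" if j: "j \<in> I" and t: "1 < t" for t j
  proof
    assume *: "t \<le> f j"
    show "j \<le> N t" by (rule order_trans[OF f(2)[OF j] N_mono[OF t *]])
  next
    assume "j \<le> N t"
    moreover have "1 \<le> j" using j I_iff by blast
    ultimately obtain s where "s \<in> Q" "t \<le> s" "j \<le> N s" using attain t by blast
    then show "t \<le> f j" using f(3)[OF j] order_trans by blast
  qed
  have "decreasing_right_eigs A f"
    unfolding decreasing_right_eigs_def Let_def I_def[symmetric]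
  proof (intro conjI ballI allI impI)
    show "1 < f j" if "j \<in> I" for j by (rule f1[OF that])
    show "f j \<le> f i" if "i \<in> I" "j \<in> I" "i \<le> j" for i j
      using ge[OF that(1) f1[OF that(2)]] f(2)[OF that(2)] that(3) by simp
    fix t :: real assume t: "1 < t"
    \<comment> \<open>\<open>B\<close> counts the eigenvalues strictly above \<open>t\<close>. The
      indices with value exactly \<open>t\<close> are then those after \<open>card B\<close> up to
      \<open>N t\<close>, and their number is the multiplicity of \<open>t\<close>.\<close>
    define B where "B = {p \<in> eigs_above A t. t < fst p}"
    have finB: "finite B" using fin[OF t] by (simp add: B_def)
    have gt: "t < f j \<longleftrightarrow> j \<le> card B" if j: "j \<in> I" for j
    proof
      assume "t < f j"
      then have "eigs_above A (f j) \<subseteq> B" by (auto simp: B_def eigs_above_def)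
      then show "j \<le> card B"
        using f(2)[OF j] card_mono[OF finB] unfolding N_def by (meson order_trans)
    next
      assume jB: "j \<le> card B"
      have "1 \<le> j" using j I_iff by blast
      then have "B \<noteq> {}" using jB by auto
      then have "Min (fst ` B) \<in> fst ` B" using finB by (intro Min_in) auto
      then have less: "t < Min (fst ` B)" by (auto simp: B_def)
      have "B \<subseteq> eigs_above A (Min (fst ` B))"
      proof
        fix q assume q: "q \<in> B"
        then have "Min (fst ` B) \<le> fst q" using finB by (intro Min_le) auto
        then show "q \<in> eigs_above A (Min (fst ` B))" using q by (auto simp: B_def eigs_above_def)
      qed
      moreover have t': "1 < Min (fst ` B)" using t less by simp
      ultimately have "j \<le> N (Min (fst ` B))"
        using jB card_mono[OF fin[OF t']] unfolding N_def by (meson order_trans)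
      then have "Min (fst ` B) \<le> f j" using ge[OF j t'] by simp
      then show "t < f j" using less by simp
    qed
    have "{j \<in> I. f j = t} = {card B<..N t}"
    proof (intro set_eqI)
      fix j
      show "j \<in> {j \<in> I. f j = t} \<longleftrightarrow> j \<in> {card B<..N t}"
      proof (cases "j \<in> I")
        case True
        then show ?thesis using ge[OF True t] gt[OF True] by auto
      next
        case False
        then show ?thesis using I_iff[of j] t by force
      qed
    qed
    then have "ecard {j \<in> I. f j = t} = enat (N t - card B)"
      by (simp add: ecard_def)
    also have "N t - card B = card (eigs_above A t - B)"
      unfolding N_def by (rule card_Diff_subset[symmetric, OF finB]) (auto simp: B_def)
    also have "eigs_above A t - B = Pair t ` {k. enat k < multiplicity_eig A (of_real t)}"
      by (auto simp: B_def eigs_above_def)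
    finally have *: "ecard {j \<in> I. f j = t} = enat (card {k. enat k < multiplicity_eig A (of_real t)})"
      by (simp add: card_image inj_on_def)
    have "Pair t ` {k. enat k < multiplicity_eig A (of_real t)} \<subseteq> eigs_above A t"
      by (auto simp: eigs_above_def)
    then have "finite (Pair t ` {k. enat k < multiplicity_eig A (of_real t)})"
      using fin[OF t] by (rule finite_subset)
    then have "finite {k. enat k < multiplicity_eig A (of_real t)}"
      by (rule finite_imageD) (simp add: inj_on_def)
    then show "ecard {j \<in> I. f j = t} = multiplicity_eig A (of_real t)"
      unfolding * by (cases "multiplicity_eig A (of_real t)") auto
  qed
  then show ?thesis by blast
qed

text \<open>Take \<open>t = right_eig A j\<close> as threshold: \<open>A\<close> has at least
  \<open>j\<close> eigenvalues from \<open>t\<close> on, so \<open>B\<close> has too, and its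
  \<open>j\<close>-th value is at least \<open>t\<close>.\<close>

lemma right_eig_comparison:
  assumes finA: "\<And>t. 1 < t \<Longrightarrow> finite (eigs_above A t)"
    and finB: "\<And>t. 1 < t \<Longrightarrow> finite (eigs_above B t)"
    and le: "\<And>t. 1 < t \<Longrightarrow> card (eigs_above A t) \<le> card (eigs_above B t)"
  shows "num_right_eigs A \<le> num_right_eigs B"
    and "1 \<le> j \<Longrightarrow> enat j \<le> num_right_eigs A \<Longrightarrow> right_eig A j \<le> right_eig B j"
proof -
  have num: "enat j \<le> num_right_eigs B" if "1 \<le> j" "enat j \<le> num_right_eigs A" for j
    using num_right_eigs_ge_iff[OF finA that(1)] num_right_eigs_ge_iff[OF finB that(1)] le that
    by (meson order_trans)
  show "num_right_eigs A \<le> num_right_eigs B"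
  proof (cases "num_right_eigs A")
    case (enat n)
    then show ?thesis using num[of n] by (cases "n = 0") (auto simp: zero_enat_def[symmetric])
  next
    case infinity
    show ?thesis
    proof (cases "num_right_eigs B")
      case (enat n)
      then show ?thesis using num[of "Suc n"] infinity by simp
    qed simp
  qed
  have A: "decreasing_right_eigs A (right_eig A)"
    unfolding right_eig_def by (rule someI_ex[OF decreasing_right_eigs_exists[OF finA]])
  have B: "decreasing_right_eigs B (right_eig B)"
    unfolding right_eig_def by (rule someI_ex[OF decreasing_right_eigs_exists[OF finB]])
  show "right_eig A j \<le> right_eig B j" if j: "1 \<le> j" "enat j \<le> num_right_eigs A"
  proof -
    have t: "1 < right_eig A j"
      using A j by (simp add: decreasing_right_eigs_def)
    then have "j \<le> card (eigs_above A (right_eig A j))"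
      using decreasing_right_eigs_ge_iff[OF finA A j t] by simp
    then have "j \<le> card (eigs_above B (right_eig A j))"
      using le[OF t] by simp
    then show ?thesis
      using decreasing_right_eigs_ge_iff[OF finB B j(1) num[OF j] t] by simp
  qed
qed

text \<open>\<open>D\<close> and \<open>M\<close> range over all Williamson forms of
  \<open>S\<close>, so the conclusion does not depend on the choice of normal form. The middle
  conjunct guarantees that every \<open>right_eig S j\<close> in the last one is an actual
  eigenvalue.\<close>

theorem corollary10:
  fixes S :: "('h::{real_inner, complete_space, second_countable_topology}) \<times> 'h \<Rightarrow> 'h \<times> 'h"
    and D :: "'h \<Rightarrow> 'h" and M :: "'h \<times> 'h \<Rightarrow> 'h \<times> 'h"
  assumes "\<not> (\<exists>B::'h set. finite B \<and> span B = UNIV)"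
    and "gaussian_covariance_operator S"
    and "williamson_form S D M"
  shows "spectrum D \<subseteq> complex_of_real ` {1..} \<and>
    num_right_eigs D \<le> num_right_eigs S \<and>
    (\<forall>j\<ge>1. enat j \<le> num_right_eigs D \<longrightarrow> right_eig D j \<le> right_eig S j)"
proof -
  note W = assms(3)
  have symS: "symmetric_op S"
    and pos: "cpositive (\<lambda>w. complexify S w - cscale \<i> (complexify J_op w))"
    and hs: "hilbert_schmidt (\<lambda>w. S w - w)"
    using assms(2) by (auto simp: gaussian_covariance_operator_def)
  have symD: "symmetric_op D"
    using W by (simp add: williamson_form_def positive_op_def)
  have D1: "(norm x)\<^sup>2 \<le> D x \<bullet> x" for x
    by (rule symplectic_spectrum_ge_one[OF cpositive_imp_J_op_le[OF pos] W])
  have "symmetric_op (\<lambda>w. S w - w)"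
    using symS unfolding symmetric_op_def
    by (auto intro: bounded_linear_sub bounded_linear_ident simp: inner_simps)
  from hilbert_schmidt_orthonormal_bound[OF hs this] obtain C
    where C: "\<And>F. finite_orthonormal F \<Longrightarrow> (\<Sum>f\<in>F. (norm (S f - f))\<^sup>2) \<le> C"
    by blast
  have main: "finite (eigs_above S t)" "finite (eigs_above D t)"
    "card (eigs_above D t) \<le> card (eigs_above S t)" if t: "1 < t" for t
  proof -
    obtain F where F: "max_eigsystem S t F"
      using max_eigsystem_exists[of S t] eigsystem_card_bound[OF C t] by blast
    then have on: "finite_orthonormal F"
      by (simp add: max_eigsystem_def eigsystem_def)
    have le: "card G \<le> card F" if "eigsystem D t G" for G
    proof (rule symplectic_eigsystem_card_le[OF W D1 _ on _ that])
      show "0 < t" using t by simp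
      show "S w \<bullet> w < t * (norm w)\<^sup>2" if "\<And>f. f \<in> F \<Longrightarrow> w \<bullet> f = 0" "w \<noteq> 0" for w
        by (rule max_eigsystem_form_less[OF symS C t F that])
    qed
    \<comment> \<open>The size of \<open>F\<close> bounds every system for \<open>D\<close>, so a
      maximal one exists.\<close>
    then obtain G where G: "max_eigsystem D t G"
      using max_eigsystem_exists by blast
    show "finite (eigs_above S t)" "finite (eigs_above D t)"
      using card_eigs_above(1) F G symS symD by blast+
    show "card (eigs_above D t) \<le> card (eigs_above S t)"
      using card_eigs_above(2)[OF F symS] card_eigs_above(2)[OF G symD] le G
      by (simp add: max_eigsystem_def)
  qed
  show ?thesis
    using spectrum_ge_one[OF symD D1] right_eig_comparison[OF main(2,1,3)] by simp
qed

end
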